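(* Let $T$ and $S$ be linear operators in a complex Hilbert space $H$ with $0\notin W_e(T)$ and such that one of the following holds: (a) $T=T_1+iT_2$ and $S=S_1+iS_2$ with symmetric operators $T_1,T_2$ and $S_1,S_2$ such that (i) $T_1$ is selfadjoint and semibounded and $S_1,S_2$ are $T_1$-compact, or (ii) $T_2$ is selfadjoint and semibounded and $S_1,S_2$ are $T_2$-compact, or (iii) $T_1,T_2$ are selfadjoint and semibounded, $S_1$ is $T_1$-compact and $S_2$ is $T_2$-compact; (b) $T=T_1+iT_2$ with uniformly positive $T_1$ and symmetric $T_2$ such that $T_1^{-1/2}S$ is $T_1^{1/2}$-compact, i.e. $T_1^{-1/2}ST_1^{-1/2}$ is compact. Then, for any linear operator $B$ in $H$ with $\operatorname{dom}(T)\subseteq\operatorname{dom}(B)$, $$w_e(T+S,B)=w_e(T,B),$$ and, for any linear operator $A$ in $H$ with $\operatorname{dom}(A)\subseteq\operatorname{dom}(T)$, $$w_e(A,T+S)=w_e(A,T).$$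
   Context: For a linear operator $R$ in $H$, $W_e(R)$ is the set of all $\mu\in\mathbb C$ for which there are $x_n\in\operatorname{dom}(R)$ with $\|x_n\|=1$, $x_n\to0$ weakly and $\langle Rx_n,x_n\rangle\to\mu$. For linear operators $A,B$ with $\operatorname{dom}(A)\subseteq\operatorname{dom}(B)$, $w_e(A,B)$ is the set of all limits $\lim_{n\to\infty}\frac{\langle Ax_n,x_n\rangle}{\langle Bx_n,x_n\rangle}$ with $x_n\in\operatorname{dom}(A)$, $\langle Bx_n,x_n\rangle\neq0$, $\|x_n\|=1$, $x_n\to0$ weakly. Sums of operators are defined on the intersection of domains, e.g. $\operatorname{dom}(T_1+iT_2)=\operatorname{dom}(T_1)\cap\operatorname{dom}(T_2)$. An operator $R_1$ is $R_2$-compact if $\operatorname{dom}(R_2)\subseteq\operatorname{dom}(R_1)$ and, whenever $(x_n)\subset\operatorname{dom}(R_2)$ has $(x_n)$ and $(R_2x_n)$ bounded, $(R_1x_n)$ has a convergent subsequence. Uniformly positive means selfadjoint and $\ge c$ for some constant $c>0$. *)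

theory Defs
  imports "HOL-Analysis.Analysis"
begin

text \<open>Complex Hilbert spaces. The complex inner product is linear in the first argument, and its
  real part is the inner product of the underlying real Hilbert space, so that norm, topology and
  completeness are those of the library.\<close>

class chilbert_space = real_inner + complete_space +
  fixes scaleC :: "complex \<Rightarrow> 'a \<Rightarrow> 'a" (infixr \<open>*\<^sub>C\<close> 75)
    and cinner :: "'a \<Rightarrow> 'a \<Rightarrow> complex"
  assumes scaleC_add_right: "c *\<^sub>C (x + y) = c *\<^sub>C x + c *\<^sub>C y"
    and scaleC_add_left: "(c + d) *\<^sub>C x = c *\<^sub>C x + d *\<^sub>C x"
    and scaleC_scaleC: "c *\<^sub>C d *\<^sub>C x = (c * d) *\<^sub>C x"
    and scaleC_of_real: "complex_of_real r *\<^sub>C x = r *\<^sub>R x"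
    and cinner_add_left: "cinner (x + y) z = cinner x z + cinner y z"
    and cinner_scaleC_left: "cinner (c *\<^sub>C x) y = c * cinner x y"
    and cinner_commute: "cinner x y = cnj (cinner y x)"
    and Re_cinner: "Re (cinner x y) = inner x y"

definition weakly_null :: "(nat \<Rightarrow> 'a::chilbert_space) \<Rightarrow> bool" where
  "weakly_null x \<longleftrightarrow> (\<forall>y. (\<lambda>n. cinner (x n) y) \<longlonglongrightarrow> 0)"

text \<open>An operator in \<open>H\<close>, possibly unbounded, is a partial function on \<open>H\<close>: the value at \<open>x\<close> is
  \<open>the (T x)\<close>, the domain is \<open>dom T\<close>, equality includes equality of domains, and the product of
  operators with its natural domain is the library's \<open>T \<circ>\<^sub>m S\<close>.\<close>

definition linear_op :: "('a::chilbert_space \<rightharpoonup> 'a) \<Rightarrow> bool" where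
  "linear_op T \<longleftrightarrow> 0 \<in> dom T \<and>
     (\<forall>x\<in>dom T. \<forall>y\<in>dom T. T (x + y) = Some (the (T x) + the (T y))) \<and>
     (\<forall>c. \<forall>x\<in>dom T. T (c *\<^sub>C x) = Some (c *\<^sub>C the (T x)))"

definition op_add :: "('a::chilbert_space \<rightharpoonup> 'a) \<Rightarrow> ('a \<rightharpoonup> 'a) \<Rightarrow> ('a \<rightharpoonup> 'a)"
    (infixl \<open>+\<^sub>o\<close> 65) where
  "T +\<^sub>o S = (\<lambda>x. if x \<in> dom T \<inter> dom S then Some (the (T x) + the (S x)) else None)"

definition op_scale :: "complex \<Rightarrow> ('a::chilbert_space \<rightharpoonup> 'a) \<Rightarrow> ('a \<rightharpoonup> 'a)"
    (infixr \<open>*\<^sub>o\<close> 75) where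
  "c *\<^sub>o T = (\<lambda>x. map_option ((*\<^sub>C) c) (T x))"

text \<open>Meaningful for injective \<open>T\<close>.\<close>

definition op_inverse :: "('a::chilbert_space \<rightharpoonup> 'a) \<Rightarrow> ('a \<rightharpoonup> 'a)" where
  "op_inverse T = (\<lambda>y. if y \<in> ran T then Some (THE x. T x = Some y) else None)"

text \<open>Meaningful for densely defined \<open>T\<close>, where the vector \<open>z\<close> is unique.\<close>

definition op_adjoint :: "('a::chilbert_space \<rightharpoonup> 'a) \<Rightarrow> ('a \<rightharpoonup> 'a)" where
  "op_adjoint T = (\<lambda>y.
     if \<exists>z. \<forall>x\<in>dom T. cinner (the (T x)) y = cinner x z
     then Some (THE z. \<forall>x\<in>dom T. cinner (the (T x)) y = cinner x z) else None)"

definition selfadjoint_op :: "('a::chilbert_space \<rightharpoonup> 'a) \<Rightarrow> bool" where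
  "selfadjoint_op T \<longleftrightarrow> linear_op T \<and> closure (dom T) = UNIV \<and> op_adjoint T = T"

text \<open>Symmetric operators are not required to be densely defined.\<close>

definition symmetric_op :: "('a::chilbert_space \<rightharpoonup> 'a) \<Rightarrow> bool" where
  "symmetric_op T \<longleftrightarrow> linear_op T \<and>
     (\<forall>x\<in>dom T. \<forall>y\<in>dom T. cinner (the (T x)) y = cinner x (the (T y)))"

text \<open>For symmetric \<open>T\<close> the numbers \<open>cinner (the (T x)) x\<close> are real, so that taking real parts
  in the following definitions loses nothing.\<close>

definition bounded_below_by :: "('a::chilbert_space \<rightharpoonup> 'a) \<Rightarrow> real \<Rightarrow> bool" where
  "bounded_below_by T c \<longleftrightarrow> (\<forall>x\<in>dom T. c * (norm x)\<^sup>2 \<le> Re (cinner (the (T x)) x))"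

definition bounded_above_by :: "('a::chilbert_space \<rightharpoonup> 'a) \<Rightarrow> real \<Rightarrow> bool" where
  "bounded_above_by T c \<longleftrightarrow> (\<forall>x\<in>dom T. Re (cinner (the (T x)) x) \<le> c * (norm x)\<^sup>2)"

definition semibounded_op :: "('a::chilbert_space \<rightharpoonup> 'a) \<Rightarrow> bool" where
  "semibounded_op T \<longleftrightarrow> (\<exists>c. bounded_below_by T c) \<or> (\<exists>c. bounded_above_by T c)"

definition uniformly_positive_op :: "('a::chilbert_space \<rightharpoonup> 'a) \<Rightarrow> bool" where
  "uniformly_positive_op T \<longleftrightarrow> selfadjoint_op T \<and> (\<exists>c>0. bounded_below_by T c)"

text \<open>The unique nonnegative selfadjoint square root of a nonnegative selfadjoint operator.\<close>

definition op_sqrt :: "('a::chilbert_space \<rightharpoonup> 'a) \<Rightarrow> ('a \<rightharpoonup> 'a)" where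
  "op_sqrt T = (THE R. selfadjoint_op R \<and> bounded_below_by R 0 \<and> R \<circ>\<^sub>m R = T)"

definition relatively_compact_op :: "('a::chilbert_space \<rightharpoonup> 'a) \<Rightarrow> ('a \<rightharpoonup> 'a) \<Rightarrow> bool" where
  "relatively_compact_op R1 R2 \<longleftrightarrow> dom R2 \<subseteq> dom R1 \<and>
     (\<forall>x :: nat \<Rightarrow> 'a. range x \<subseteq> dom R2 \<longrightarrow> bounded (range x) \<longrightarrow>
        bounded (range (\<lambda>n. the (R2 (x n)))) \<longrightarrow>
        (\<exists>r. strict_mono r \<and> convergent (\<lambda>n. the (R1 (x (r n))))))"

definition ess_num_range :: "('a::chilbert_space \<rightharpoonup> 'a) \<Rightarrow> complex set" where
  "ess_num_range R = {\<mu>. \<exists>x. (\<forall>n. x n \<in> dom R \<and> norm (x n) = 1) \<and> weakly_null x \<and>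
     (\<lambda>n. cinner (the (R (x n))) (x n)) \<longlonglongrightarrow> \<mu>}"

text \<open>The essential numerical range \<open>w\<^sub>e(A, B)\<close> of a pair with \<open>dom A \<subseteq> dom B\<close>.\<close>

definition ess_num_range_pair ::
    "('a::chilbert_space \<rightharpoonup> 'a) \<Rightarrow> ('a \<rightharpoonup> 'a) \<Rightarrow> complex set" where
  "ess_num_range_pair A B = {\<mu>. \<exists>x.
     (\<forall>n. x n \<in> dom A \<and> cinner (the (B (x n))) (x n) \<noteq> 0 \<and> norm (x n) = 1) \<and> weakly_null x \<and>
     (\<lambda>n. cinner (the (A (x n))) (x n) / cinner (the (B (x n))) (x n)) \<longlonglongrightarrow> \<mu>}"

end

theory Submission imports Defs begin

text \<open>Every case reduces to one claim: for weakly null unit vectors \<open>x\<^sub>n \<in> dom T\<close>, the quotients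
  \<open>\<langle>S x\<^sub>n, x\<^sub>n\<rangle> / (1 + |\<langle>T x\<^sub>n, x\<^sub>n\<rangle>|)\<close> tend to \<open>0\<close>. Since \<open>0 \<notin> W\<^sub>e(T)\<close> keeps \<open>\<langle>T x\<^sub>n, x\<^sub>n\<rangle>\<close> away
  from \<open>0\<close>, the forms of \<open>T + S\<close> and \<open>T\<close> are then asymptotically equal along such sequences.

  For symmetric \<open>S\<close> that is compact relative to a selfadjoint \<open>G \<ge> 1\<close> (a shift of \<open>T\<^sub>1\<close> or \<open>-T\<^sub>1\<close>),
  interpolation is avoided as follows. Put \<open>E = G (G + r)\<inverse>\<close>. As \<open>1 - E\<close> maps into \<open>dom G\<close> with
  \<open>G (1 - E)\<close> bounded, the parts of \<open>\<langle>S x\<^sub>n, x\<^sub>n\<rangle>\<close> that involve \<open>(1 - E) x\<^sub>n\<close> vanish in the limit. The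
  rest, \<open>\<langle>S E x, E x\<rangle>\<close>, is the energy form \<open>\<langle>G M x, x\<rangle>\<close> of \<open>M = G\<inverse> E S E\<close>, which is symmetric for the
  energy inner product and has norm at most \<open>\<parallel>E S G\<inverse>\<parallel>\<close> in the graph norm; by Lax's lemma on symmetrizable
  operators its energy norm is no larger, and \<open>\<parallel>E S G\<inverse>\<parallel>\<close> is small for large \<open>r\<close> because \<open>S G\<inverse>\<close> is
  compact.

  In case (b), \<open>\<langle>S x, x\<rangle> = \<langle>T\<^sub>1\<^sup>-\<^sup>1\<^sup>/\<^sup>2 S x, T\<^sub>1\<^sup>1\<^sup>/\<^sup>2 x\<rangle>\<close>, and after normalising by \<open>\<parallel>T\<^sub>1\<^sup>1\<^sup>/\<^sup>2 x\<^sub>n\<parallel>\<close> this pairs a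
  relatively compact sequence with a weakly null one.\<close>

section \<open>Real Hilbert spaces\<close>

text \<open>Take a point outside \<open>V\<close> and a minimising sequence for its distance to
  \<open>V\<close>. The parallelogram law makes the sequence Cauchy, and the difference to the
  nearest point is orthogonal to \<open>V\<close>.\<close>

lemma closed_subspace_orthogonal:
  fixes V :: "'a::{real_inner,complete_space} set"
  assumes sub: "subspace V" and cl: "closed V" and ne: "V \<noteq> UNIV"
  obtains y where "y \<noteq> 0" "\<forall>v\<in>V. inner v y = 0"
proof -
  obtain p where p: "p \<notin> V" using ne by blast
  have V0: "0 \<in> V" using sub by (rule subspace_0)
  define d where "d = infdist p V"
  have d_le: "d \<le> norm (p - v)" if "v \<in> V" for v
    unfolding d_def using infdist_le[OF that, of p] by (simp add: dist_norm)
  have d0: "d \<ge> 0" by (simp add: d_def infdist_nonneg)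
  have "\<exists>v\<in>V. norm (p - v) < d + 1 / real (Suc n)" for n
  proof -
    have "infdist p V < d + 1 / real (Suc n)" by (simp add: d_def)
    then show ?thesis
      using V0 by (subst (asm) infdist_notempty, force, subst (asm) cINF_less_iff)
        (auto simp: dist_norm intro!: bdd_belowI2[of _ 0])
  qed
  then obtain v where v: "\<And>n. v n \<in> V" "\<And>n. norm (p - v n) < d + 1 / real (Suc n)"
    by metis
  have lim_d: "(\<lambda>n. norm (p - v n)) \<longlonglongrightarrow> d"
  proof (rule tendsto_sandwich[of "\<lambda>_. d" _ _ "\<lambda>n. d + 1 / real (Suc n)"])
    show "(\<lambda>n. d + 1 / real (Suc n)) \<longlonglongrightarrow> d"
      using tendsto_add[OF tendsto_const LIMSEQ_inverse_real_of_nat, of d]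
      by (simp add: inverse_eq_divide)
  qed (use v d_le in \<open>auto intro!: always_eventually less_imp_le\<close>)
  \<comment> \<open>The midpoint of \<open>v m\<close> and \<open>v n\<close> lies in
    \<open>V\<close>, so its distance to \<open>p\<close> is at least \<open>d\<close>; the
    parallelogram law then bounds the gap by the two excesses over \<open>d\<close>.\<close>
  have par: "(norm (v m - v n))\<^sup>2 \<le> 2 * (norm (p - v m))\<^sup>2 + 2 * (norm (p - v n))\<^sup>2 - 4 * d\<^sup>2" for m n
  proof -
    have "(1/2) *\<^sub>R (v m + v n) \<in> V"
      using v(1) sub by (simp add: subspace_add subspace_scale)
    then have "d\<^sup>2 \<le> (norm (p - (1/2) *\<^sub>R (v m + v n)))\<^sup>2"
      using d_le d0 by (intro power_mono) auto
    moreover have "(norm (v m - v n))\<^sup>2 + 4 * (norm (p - (1/2) *\<^sub>R (v m + v n)))\<^sup>2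
        = 2 * (norm (p - v m))\<^sup>2 + 2 * (norm (p - v n))\<^sup>2"
      by (simp add: power2_norm_eq_inner inner_diff_left inner_diff_right inner_add_left
          inner_add_right inner_commute algebra_simps)
    ultimately show ?thesis by linarith
  qed
  have "Cauchy v"
  proof (rule metric_CauchyI)
    fix e :: real assume e: "e > 0"
    have "(\<lambda>n. (norm (p - v n))\<^sup>2) \<longlonglongrightarrow> d\<^sup>2" by (intro tendsto_power lim_d)
    then have "\<forall>\<^sub>F n in sequentially. (norm (p - v n))\<^sup>2 < d\<^sup>2 + e\<^sup>2 / 4"
      using e by (intro order_tendstoD) auto
    then obtain N where N: "\<And>n. n \<ge> N \<Longrightarrow> (norm (p - v n))\<^sup>2 < d\<^sup>2 + e\<^sup>2 / 4"
      by (auto simp: eventually_sequentially)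
    have "dist (v m) (v n) < e" if "m \<ge> N" "n \<ge> N" for m n
    proof -
      have "(norm (v m - v n))\<^sup>2 < e\<^sup>2" using par[of m n] N[OF that(1)] N[OF that(2)] by linarith
      then show ?thesis using e by (simp add: dist_norm power2_less_imp_less)
    qed
    then show "\<exists>N. \<forall>m\<ge>N. \<forall>n\<ge>N. dist (v m) (v n) < e" by blast
  qed
  then obtain q where q: "v \<longlonglongrightarrow> q" using Cauchy_convergent convergent_def by blast
  have qV: "q \<in> V" using closed_sequentially[OF cl] v(1) q by blast
  have "(\<lambda>n. norm (p - v n)) \<longlonglongrightarrow> norm (p - q)" by (intro tendsto_intros q)
  then have dq: "norm (p - q) = d" using lim_d LIMSEQ_unique by blast
  show ?thesis
  proof
    show "p - q \<noteq> 0" using p qV by auto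
    show "\<forall>u\<in>V. inner u (p - q) = 0"
    proof
      fix u assume u: "u \<in> V"
      show "inner u (p - q) = 0"
      proof (cases "u = 0")
        case False
        \<comment> \<open>This \<open>t\<close> minimises the quadratic polynomial
          \<open>norm (p - q - t u)^2\<close>, whose minimal value exposes the inner product to be
          annihilated.\<close>
        define t where "t = inner u (p - q) / inner u u"
        have uu: "inner u u > 0" using False by simp
        have "q + t *\<^sub>R u \<in> V" using qV u sub by (simp add: subspace_add subspace_scale)
        then have "(norm (p - q))\<^sup>2 \<le> (norm (p - q - t *\<^sub>R u))\<^sup>2"
          using d_le[of "q + t *\<^sub>R u"] dq d0 by (intro power_mono) (auto simp: algebra_simps)
        also have "\<dots> = (norm (p - q))\<^sup>2 - 2 * t * inner u (p - q) + t\<^sup>2 * inner u u"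
          by (simp add: power2_norm_eq_inner inner_diff_left inner_diff_right inner_commute)
            (simp add: power2_eq_square algebra_simps)
        also have "\<dots> = (norm (p - q))\<^sup>2 - (inner u (p - q))\<^sup>2 / inner u u"
          using uu by (simp add: t_def power2_eq_square field_simps)
        finally have "(inner u (p - q))\<^sup>2 / inner u u \<le> 0" by simp
        then have "(inner u (p - q))\<^sup>2 \<le> 0" using uu by (simp add: divide_le_0_iff)
        then show ?thesis by simp
      qed simp
    qed
  qed
qed

lemma subspace_closure:
  fixes V :: "'a::real_normed_vector set"
  assumes "subspace V" shows "subspace (closure V)"
proof (rule subspaceI)
  show "0 \<in> closure V" using subspace_0[OF assms] closure_subset by blast
next
  fix x y assume "x \<in> closure V" "y \<in> closure V"
  then obtain f g where "\<And>n. f n \<in> V" "f \<longlonglongrightarrow> x" "\<And>n. g n \<in> V" "g \<longlonglongrightarrow> y"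
    unfolding closure_sequential by blast
  then have "\<And>n. f n + g n \<in> V" "(\<lambda>n. f n + g n) \<longlonglongrightarrow> x + y"
    using assms by (auto intro: subspace_add tendsto_add)
  then show "x + y \<in> closure V"
    unfolding closure_sequential by (intro exI[of _ "\<lambda>n. f n + g n"]) simp
next
  fix c x assume "x \<in> closure V"
  then obtain f where "\<And>n. f n \<in> V" "f \<longlonglongrightarrow> x" unfolding closure_sequential by blast
  then have "\<And>n. c *\<^sub>R f n \<in> V" "(\<lambda>n. c *\<^sub>R f n) \<longlonglongrightarrow> c *\<^sub>R x"
    using assms by (auto intro: subspace_scale tendsto_intros)
  then show "c *\<^sub>R x \<in> closure V"
    unfolding closure_sequential by (intro exI[of _ "\<lambda>n. c *\<^sub>R f n"]) simp
qed

text \<open>The discriminant argument on \<open>D\<close>. The form may be degenerate at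
  \<open>y\<close>, and then a linear polynomial that stays nonnegative must be constant.\<close>

lemma form_Cauchy_Schwarz:
  fixes G :: "'a::real_inner \<Rightarrow> 'a"
  assumes "subspace D"
    and add: "\<And>x y. x \<in> D \<Longrightarrow> y \<in> D \<Longrightarrow> G (x + y) = G x + G y"
    and scale: "\<And>r x. x \<in> D \<Longrightarrow> G (r *\<^sub>R x) = r *\<^sub>R G x"
    and sym: "\<And>x y. x \<in> D \<Longrightarrow> y \<in> D \<Longrightarrow> inner (G x) y = inner x (G y)"
    and nonneg: "\<And>x. x \<in> D \<Longrightarrow> 0 \<le> inner (G x) x"
    and x: "x \<in> D" and y: "y \<in> D"
  shows "(inner (G x) y)\<^sup>2 \<le> inner (G x) x * inner (G y) y"
proof -
  define a b c where "a = inner (G x) x" and "b = inner (G x) y" and "c = inner (G y) y"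
  have quad: "0 \<le> a + 2 * t * b + t\<^sup>2 * c" for t
  proof -
    have ty: "t *\<^sub>R y \<in> D" using assms(1) y by (simp add: subspace_scale)
    have "0 \<le> inner (G (x + t *\<^sub>R y)) (x + t *\<^sub>R y)"
      using assms(1) x ty by (intro nonneg) (simp add: subspace_add)
    also have "\<dots> = a + 2 * t * b + t\<^sup>2 * c"
      using sym[OF y x] by (simp add: add[OF x ty] scale[OF y] a_def b_def c_def inner_add_left
          inner_add_right inner_commute power2_eq_square algebra_simps)
    finally show ?thesis .
  qed
  have c: "c \<ge> 0" using nonneg y by (simp add: c_def)
  show ?thesis
  proof (cases "c = 0")
    case True
    have "b = 0"
    proof (rule ccontr)
      assume "b \<noteq> 0"
      \<comment> \<open>With \<open>c = 0\<close> the polynomial is \<open>a + 2 t b\<close>, which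
        takes the value -1 at this \<open>t\<close>.\<close>
      then show False using quad[of "- (a + 1) / (2 * b)"] True by (simp add: field_simps)
    qed
    then show ?thesis using True by (simp add: a_def b_def c_def)
  next
    case False
    then have "0 \<le> a - b\<^sup>2 / c"
      using quad[of "- b / c"] by (simp add: power2_eq_square field_simps)
    then have "b\<^sup>2 \<le> a * c" using False c by (simp add: field_simps)
    then show ?thesis by (simp add: a_def b_def c_def)
  qed
qed

text \<open>The exponents \<open>2 ^ m\<close> are unbounded, so a base above 1 would escape
  \<open>C\<close>. This turns a growth estimate for iterated squares into a bound free of
  constants.\<close>

lemma le_one_of_bounded_powers:
  fixes r C :: real
  assumes "\<And>m. r ^ 2 ^ m \<le> C"
  shows "r \<le> 1"
proof (rule ccontr)
  assume "\<not> r \<le> 1"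
  then obtain n where n: "C < r ^ n" using real_arch_pow by force
  have "n \<le> 2 ^ n" by (rule less_imp_le[OF less_exp])
  then have "r ^ n \<le> r ^ 2 ^ n" using \<open>\<not> r \<le> 1\<close> by (intro power_increasing) auto
  then show False using n assms[of n] by linarith
qed

text \<open>Compactness only ever yields convergent subsequences. If \<open>f\<close> failed to tend
  to 0, the indices with norm at least \<open>e\<close> would form a subsequence without any null
  subsequence.\<close>

lemma tendsto_zero_subseqI:
  fixes f :: "nat \<Rightarrow> 'b::real_normed_vector"
  assumes "\<And>r :: nat \<Rightarrow> nat. strict_mono r \<Longrightarrow> \<exists>s :: nat \<Rightarrow> nat. strict_mono s \<and> (\<lambda>n. f (r (s n))) \<longlonglongrightarrow> 0"
  shows "f \<longlonglongrightarrow> 0"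
proof (rule ccontr)
  assume "\<not> f \<longlonglongrightarrow> 0"
  then obtain e where e: "e > 0" "\<not> (\<forall>\<^sub>F n in sequentially. norm (f n) < e)"
    by (auto simp: tendsto_iff)
  then have inf: "infinite {n. \<not> norm (f n) < e}"
    by (simp add: not_eventually frequently_cofinite flip: cofinite_eq_sequentially)
  define r where "r = enumerate {n. \<not> norm (f n) < e}"
  have "strict_mono r" unfolding r_def by (rule strict_mono_enumerate[OF inf])
  then obtain s where s: "(\<lambda>n. f (r (s n))) \<longlonglongrightarrow> 0" using assms by blast
  have "\<not> norm (f (r (s n))) < e" for n
    using enumerate_in_set[OF inf, of "s n"] by (simp add: r_def)
  moreover have "\<forall>\<^sub>F n in sequentially. norm (f (r (s n))) < e"
    using s e(1) by (auto simp: tendsto_iff)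
  ultimately show False by (simp add: eventually_sequentially)
qed

text \<open>A strongly convergent sequence paired with a bounded one that is null against the limit:
  replace \<open>a n\<close> by \<open>w\<close> at a cost of at most
  \<open>C * norm (a n - w)\<close>.\<close>

lemma inner_tendsto_zero:
  fixes a x :: "nat \<Rightarrow> 'b::real_inner"
  assumes a: "a \<longlonglongrightarrow> w" and x: "(\<lambda>n. inner w (x n)) \<longlonglongrightarrow> 0" and bd: "\<And>n. norm (x n) \<le> C"
  shows "(\<lambda>n. inner (a n) (x n)) \<longlonglongrightarrow> 0"
proof -
  have "(\<lambda>n. inner (a n - w) (x n)) \<longlonglongrightarrow> 0"
  proof (rule Lim_null_comparison)
    show "\<forall>\<^sub>F n in sequentially. norm (inner (a n - w) (x n)) \<le> norm (a n - w) * C"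
      using order_trans[OF Cauchy_Schwarz_ineq2 mult_left_mono[OF bd norm_ge_zero]] by simp
    show "(\<lambda>n. norm (a n - w) * C) \<longlonglongrightarrow> 0"
      using a by (intro tendsto_mult_left_zero tendsto_norm_zero) (simp add: LIM_zero)
  qed
  from tendsto_add[OF this x] show ?thesis by (simp add: inner_diff_left)
qed

section \<open>Symmetric perturbations that are relatively compact are form compact\<close>

text \<open>A selfadjoint operator bounded below by 1, seen over the reals, which suffices because
  forms of symmetric operators are real. Selfadjointness enters through \<open>surj\<close>, which
  supplies the resolvents at all points -r with r nonnegative.\<close>

locale coercive_operator =
  fixes D :: "'a::{real_inner,complete_space} set" and G :: "'a \<Rightarrow> 'a"
  assumes subspace: "subspace D"
    and add: "x \<in> D \<Longrightarrow> y \<in> D \<Longrightarrow> G (x + y) = G x + G y"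
    and scale: "x \<in> D \<Longrightarrow> G (r *\<^sub>R x) = r *\<^sub>R G x"
    and sym: "x \<in> D \<Longrightarrow> y \<in> D \<Longrightarrow> inner (G x) y = inner x (G y)"
    and coercive: "x \<in> D \<Longrightarrow> (norm x)\<^sup>2 \<le> inner (G x) x"
    and surj: "r \<ge> 0 \<Longrightarrow> \<exists>x\<in>D. G x + r *\<^sub>R x = y"
begin

lemma G_diff: "x \<in> D \<Longrightarrow> y \<in> D \<Longrightarrow> G (x - y) = G x - G y"
  using add[of x "(-1) *\<^sub>R y"] scale[of y "-1"] subspace_scale[OF subspace, of y "-1"] by simp

lemma form_nonneg: "x \<in> D \<Longrightarrow> 0 \<le> inner (G x) x"
  using coercive[of x] by (meson order_trans zero_le_power2)

lemma norm_le_norm_G: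
  assumes "x \<in> D" shows "norm x \<le> norm (G x)"
proof (cases "x = 0")
  case False
  have "norm x * norm x \<le> norm (G x) * norm x"
    using coercive[OF assms] norm_cauchy_schwarz[of "G x" x] by (simp add: power2_eq_square)
  then show ?thesis using False by simp
qed simp

section \<open>Resolvents and the bounded approximations built from them\<close>

definition resolv :: "real \<Rightarrow> 'a \<Rightarrow> 'a" where
  "resolv r y = (SOME x. x \<in> D \<and> G x + r *\<^sub>R x = y)"

lemma resolv:
  assumes "r \<ge> 0"
  shows resolv_in: "resolv r y \<in> D" and G_resolv: "G (resolv r y) + r *\<^sub>R resolv r y = y"
proof -
  have "\<exists>x. x \<in> D \<and> G x + r *\<^sub>R x = y" using surj[OF assms] by blast
  then have "resolv r y \<in> D \<and> G (resolv r y) + r *\<^sub>R resolv r y = y"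
    unfolding resolv_def by (rule someI_ex)
  then show "resolv r y \<in> D" "G (resolv r y) + r *\<^sub>R resolv r y = y" by auto
qed

lemma resolv_unique:
  assumes r: "r \<ge> 0" and x: "x \<in> D" and eq: "G x + r *\<^sub>R x = y"
  shows "resolv r y = x"
proof -
  let ?z = "resolv r y - x"
  have z: "?z \<in> D" using subspace resolv_in[OF r] x by (simp add: subspace_diff)
  have "G ?z + r *\<^sub>R ?z = 0"
    using G_resolv[OF r, of y] eq by (simp add: G_diff[OF resolv_in[OF r] x] algebra_simps)
  then have "inner (G ?z) ?z + r * inner ?z ?z = 0"
    by (metis inner_add_left inner_scaleR_left inner_zero_left)
  then have "(norm ?z)\<^sup>2 \<le> 0"
    using coercive[OF z] r by (smt (verit) inner_ge_zero mult_nonneg_nonneg)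
  then show ?thesis by simp
qed

text \<open>This is the operator \<open>E = G (G + r)^-1\<close>. It is the complement
  \<open>1 - E = r (G + r)^-1\<close> that maps into \<open>D\<close> and tends to the identity;
  \<open>E\<close> itself becomes small as \<open>r\<close> grows.\<close>

definition smooth :: "real \<Rightarrow> 'a \<Rightarrow> 'a" where
  "smooth r y = G (resolv r y)"

lemma smooth_eq: "r \<ge> 0 \<Longrightarrow> smooth r y = y - r *\<^sub>R resolv r y"
  using G_resolv[of r y] by (simp add: smooth_def algebra_simps)

lemma smooth_in:
  assumes "r \<ge> 0" "y \<in> D" shows "smooth r y \<in> D"
  using assms subspace by (simp add: smooth_eq resolv_in subspace_diff subspace_scale)

lemma smooth_diff:
  assumes r: "r \<ge> 0" shows "smooth r (x - y) = smooth r x - smooth r y"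
proof -
  have "resolv r (x - y) = resolv r x - resolv r y"
    using G_resolv[OF r, of x] G_resolv[OF r, of y]
    by (intro resolv_unique[OF r])
      (simp_all add: subspace subspace_diff resolv_in r G_diff algebra_simps)
  then show ?thesis using r by (simp add: smooth_def G_diff resolv_in)
qed

text \<open>Expand the squared norm of \<open>y = G u + r u\<close> with
  \<open>u = resolv r y\<close>. All three terms are nonnegative, so each of the two squares is
  dominated by \<open>(norm y)^2\<close>.\<close>

lemma smooth_resolv_norm:
  assumes r: "r \<ge> 0"
  shows norm_smooth_le: "norm (smooth r y) \<le> norm y" and "r * norm (resolv r y) \<le> norm y"
proof -
  let ?u = "resolv r y"
  have "(norm y)\<^sup>2 = (norm (G ?u + r *\<^sub>R ?u))\<^sup>2" by (simp add: G_resolv[OF r])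
  also have "\<dots> = (norm (G ?u))\<^sup>2 + 2 * r * inner (G ?u) ?u + (r * norm ?u)\<^sup>2"
    by (simp add: power2_norm_eq_inner inner_add_left inner_add_right inner_commute
        power_mult_distrib) (simp add: power2_eq_square algebra_simps)
  finally have eq: "(norm y)\<^sup>2 = (norm (G ?u))\<^sup>2 + 2 * r * inner (G ?u) ?u + (r * norm ?u)\<^sup>2" .
  have p: "2 * r * inner (G ?u) ?u \<ge> 0" using r form_nonneg[OF resolv_in[OF r]] by simp
  have "(norm (smooth r y))\<^sup>2 \<le> (norm y)\<^sup>2"
    unfolding smooth_def using eq p zero_le_power2[of "r * norm ?u"] by linarith
  then show "norm (smooth r y) \<le> norm y" by (rule power2_le_imp_le) simp
  have "(r * norm ?u)\<^sup>2 \<le> (norm y)\<^sup>2"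
    using eq p zero_le_power2[of "norm (G ?u)"] by linarith
  then show "r * norm ?u \<le> norm y" by (rule power2_le_imp_le) simp
qed

lemma smooth_G:
  assumes r: "r \<ge> 0" and x: "x \<in> D"
  shows "smooth r (G x) = G (smooth r x)" and "resolv r (G x) = smooth r x"
proof -
  have "G (smooth r x) = G x - r *\<^sub>R smooth r x"
    using smooth_eq[OF r, of x] subspace
    by (simp add: G_diff[OF x] subspace_scale resolv_in[OF r] scale smooth_def)
  then show R: "resolv r (G x) = smooth r x"
    by (intro resolv_unique r smooth_in x) simp
  show "smooth r (G x) = G (smooth r x)" by (simp add: smooth_def[of r "G x"] R)
qed

lemma smooth_sym:
  assumes r: "r \<ge> 0"
  shows "inner (smooth r x) y = inner x (smooth r y)"
proof -
  have "inner (resolv r x) (G (resolv r y) + r *\<^sub>R resolv r y)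
      = inner (G (resolv r x) + r *\<^sub>R resolv r x) (resolv r y)"
    using sym[OF resolv_in[OF r] resolv_in[OF r]] by (simp add: inner_add_left inner_add_right)
  then show ?thesis unfolding G_resolv[OF r]
    by (simp add: smooth_eq[OF r] inner_diff_left inner_diff_right)
qed

text \<open>A vector orthogonal to \<open>D\<close> has the form \<open>G z\<close>, and pairing it
  with \<open>z\<close> itself forces \<open>z = 0\<close> by coercivity.\<close>

lemma dense: "closure D = UNIV"
proof (rule ccontr)
  assume "closure D \<noteq> UNIV"
  then obtain y where y: "y \<noteq> 0" "\<And>v. v \<in> closure D \<Longrightarrow> inner v y = 0"
    using closed_subspace_orthogonal[of "closure D"] subspace subspace_closure closed_closure by metis
  obtain z where z: "z \<in> D" "G z = y" using surj[of 0 y] by auto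
  have "(norm z)\<^sup>2 \<le> 0"
    using coercive[OF z(1)] y(2) z closure_subset[of D] by (auto simp: inner_commute)
  then have "G 0 = y" using z(2) by simp
  moreover have "G 0 = 0" using scale[OF z(1), of 0] by simp
  ultimately show False using y(1) by simp
qed

text \<open>On \<open>D\<close> the decay is explicit,
  \<open>norm (smooth n v) <= norm (G v) / n\<close>, because \<open>smooth n v\<close> is the
  resolvent applied to \<open>G v\<close>. Density and the uniform bound
  \<open>norm_smooth_le\<close> extend this to all vectors.\<close>

lemma smooth_tendsto_zero: "(\<lambda>n. smooth (real n) w) \<longlonglongrightarrow> 0"
proof (rule tendstoI)
  fix e :: real assume e: "e > 0"
  have "w \<in> closure D" using dense by simp
  then obtain v where v: "v \<in> D" "norm (w - v) < e / 2"
    using e unfolding closure_approachable by (metis dist_commute dist_norm half_gt_zero)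
  have "(\<lambda>n. norm (G v) / real n) \<longlonglongrightarrow> 0" by (rule lim_const_over_n)
  then have "\<forall>\<^sub>F n in sequentially. norm (G v) / real n < e / 2"
    using e by (intro order_tendstoD) auto
  moreover have "\<forall>\<^sub>F n::nat in sequentially. n > 0" by (rule eventually_gt_at_top)
  ultimately show "\<forall>\<^sub>F n in sequentially. dist (smooth (real n) w) 0 < e"
  proof eventually_elim
    case (elim n)
    have "real n * norm (smooth (real n) v) \<le> norm (G v)"
      using smooth_resolv_norm(2)[of "real n" "G v"] smooth_G(2)[OF _ v(1), of "real n"] by simp
    then have "norm (smooth (real n) v) \<le> norm (G v) / real n"
      using elim(2) by (simp add: field_simps)
    moreover have "norm (smooth (real n) (w - v)) \<le> norm (w - v)" by (rule norm_smooth_le) simp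
    moreover have "smooth (real n) w = smooth (real n) (w - v) + smooth (real n) v"
      by (simp add: smooth_diff)
    ultimately show ?case
      using elim(1) v(2) norm_triangle_ineq[of "smooth (real n) (w - v)" "smooth (real n) v"]
      by (simp only: dist_norm diff_zero)
  qed
qed

text \<open>Lax's argument for symmetrizable operators: Cauchy-Schwarz for the energy form, applied to
  the iterated squares of \<open>M\<close>, reduces the energy bound to the growth rate in the stronger norm.\<close>

lemma symmetrizable_bound:
  assumes M: "\<And>x. x \<in> D \<Longrightarrow> M x \<in> D"
    and M_sym: "\<And>x y. x \<in> D \<Longrightarrow> y \<in> D \<Longrightarrow> inner (G (M x)) y = inner (G x) (M y)"
    and M_bound: "\<And>x. x \<in> D \<Longrightarrow> norm (G (M x)) \<le> k * norm (G x)"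
    and k: "k > 0" and x: "x \<in> D"
  shows "\<bar>inner (G (M x)) x\<bar> \<le> k * inner (G x) x"
proof (cases "x = 0")
  case False
  define s where "s = inner (G x) x"
  have "(norm x)\<^sup>2 > 0" using False by simp
  then have s: "s > 0" using coercive[OF x] unfolding s_def by linarith
  \<comment> \<open>Each use of Cauchy-Schwarz squares the operator, so only exponents that are
    powers of two occur.\<close>
  define b where "b m = inner (G ((M ^^ 2 ^ m) x)) x" for m
  have pow_in: "(M ^^ j) y \<in> D" if "y \<in> D" for j y using that by (induction j) (auto intro: M)
  have pow_sym: "inner (G ((M ^^ j) y)) z = inner (G y) ((M ^^ j) z)" if "y \<in> D" "z \<in> D" for j y z
    using that(2)
  proof (induction j arbitrary: z)
    case (Suc j)
    have "inner (G ((M ^^ Suc j) y)) z = inner (G ((M ^^ j) y)) (M z)"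
      using that(1) Suc.prems by (simp add: M_sym pow_in)
    also have "\<dots> = inner (G y) ((M ^^ j) (M z))" using Suc M by blast
    finally show ?case by (simp add: funpow_swap1)
  qed simp
  have pow_bound: "norm (G ((M ^^ j) x)) \<le> k ^ j * norm (G x)" for j
  proof (induction j)
    case (Suc j)
    have "norm (G ((M ^^ Suc j) x)) \<le> k * norm (G ((M ^^ j) x))" using M_bound pow_in x by simp
    also have "\<dots> \<le> k * (k ^ j * norm (G x))" using Suc k by (intro mult_left_mono) auto
    finally show ?case by (simp add: mult.assoc)
  qed simp
  \<comment> \<open>In the energy form of \<open>?N x\<close> with itself, symmetry moves one factor
    \<open>?N\<close> across, which doubles the exponent and produces
    \<open>b (Suc m)\<close>.\<close>
  have step: "(b m)\<^sup>2 \<le> b (Suc m) * s" for m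
  proof -
    let ?N = "M ^^ 2 ^ m"
    have "(b m)\<^sup>2 \<le> inner (G (?N x)) (?N x) * s"
      unfolding b_def s_def
      by (rule form_Cauchy_Schwarz[OF subspace add scale sym form_nonneg pow_in[OF x] x])
    also have "inner (G (?N x)) (?N x) = inner (G (?N (?N x))) x"
      using pow_sym[OF pow_in[OF x] x] by simp
    also have "?N (?N x) = (M ^^ 2 ^ Suc m) x" by (simp add: mult_2 funpow_add)
    finally show ?thesis by (simp add: b_def)
  qed
  have iter: "(\<bar>b 0\<bar> / s) ^ 2 ^ m \<le> \<bar>b m\<bar> / s" for m
  proof (induction m)
    case (Suc m)
    have "(\<bar>b 0\<bar> / s) ^ 2 ^ Suc m = ((\<bar>b 0\<bar> / s) ^ 2 ^ m)\<^sup>2"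
      by (simp only: power_Suc mult.commute[of 2 "2 ^ m"] power_mult)
    also have "\<dots> \<le> (\<bar>b m\<bar> / s)\<^sup>2" using Suc s by (intro power_mono) auto
    also have "\<dots> = (b m)\<^sup>2 / s\<^sup>2" by (simp add: power_divide)
    also have "\<dots> \<le> b (Suc m) * s / s\<^sup>2" using step by (intro divide_right_mono) auto
    also have "\<dots> \<le> \<bar>b (Suc m)\<bar> / s" using s by (simp add: power2_eq_square divide_right_mono)
    finally show ?case .
  qed simp
  \<comment> \<open>The right-hand side does not depend on \<open>m\<close>, although it involves
    the stronger norm; taking roots removes it.\<close>
  have "(\<bar>b 0\<bar> / (k * s)) ^ 2 ^ m \<le> norm (G x) * norm x / s" for m
  proof -
    have "\<bar>b m\<bar> \<le> norm (G ((M ^^ 2 ^ m) x)) * norm x" unfolding b_def by (rule Cauchy_Schwarz_ineq2)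
    also have "\<dots> \<le> k ^ 2 ^ m * norm (G x) * norm x" using pow_bound by (intro mult_right_mono) auto
    finally have "\<bar>b m\<bar> / s \<le> k ^ 2 ^ m * (norm (G x) * norm x / s)"
      using s by (simp add: divide_right_mono mult.assoc)
    with iter[of m] have "(\<bar>b 0\<bar> / s) ^ 2 ^ m \<le> k ^ 2 ^ m * (norm (G x) * norm x / s)" by linarith
    moreover have "(\<bar>b 0\<bar> / (k * s)) ^ 2 ^ m = (\<bar>b 0\<bar> / s) ^ 2 ^ m / k ^ 2 ^ m"
      by (simp add: power_divide power_mult_distrib)
    ultimately show ?thesis using k by (simp add: divide_le_eq mult.commute)
  qed
  then have "\<bar>b 0\<bar> / (k * s) \<le> 1" by (rule le_one_of_bounded_powers)
  then show ?thesis using k s by (simp add: b_def s_def divide_le_eq)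
qed simp

end

section \<open>Form compactness of symmetric relatively compact operators\<close>

context coercive_operator
begin

context
  fixes S :: "'a \<Rightarrow> 'a"
  assumes S_add: "\<And>x y. x \<in> D \<Longrightarrow> y \<in> D \<Longrightarrow> S (x + y) = S x + S y"
    and S_scale: "\<And>r x. x \<in> D \<Longrightarrow> S (r *\<^sub>R x) = r *\<^sub>R S x"
    and S_sym: "\<And>x y. x \<in> D \<Longrightarrow> y \<in> D \<Longrightarrow> inner (S x) y = inner x (S y)"
    and S_compact: "\<And>x :: nat \<Rightarrow> 'a. range x \<subseteq> D \<Longrightarrow> bounded (range x) \<Longrightarrow>
      bounded (range (\<lambda>n. G (x n))) \<Longrightarrow> \<exists>r :: nat \<Rightarrow> nat. strict_mono r \<and> convergent (\<lambda>n. S (x (r n)))"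
begin

lemma S_diff: "x \<in> D \<Longrightarrow> y \<in> D \<Longrightarrow> S (x - y) = S x - S y"
  using S_add[of x "(-1) *\<^sub>R y"] S_scale[of y "-1"] subspace_scale[OF subspace, of y "-1"] by simp

text \<open>Strong convergence to \<open>0\<close> of the uniformly bounded operators \<open>smooth n\<close> is uniform on the
  relatively compact image of the unit ball under \<open>S G\<inverse>\<close>.\<close>

lemma smooth_S_small:
  assumes e: "e > 0"
  obtains n :: nat where "\<And>x. x \<in> D \<Longrightarrow> norm (smooth (real n) (S x)) \<le> e * norm (G x)"
proof (rule ccontr)
  assume "\<not> thesis"
  then have "\<forall>n. \<exists>x. x \<in> D \<and> e * norm (G x) < norm (smooth (real n) (S x))"
    using that by (meson not_le)
  then obtain x where x: "\<And>n. x n \<in> D" "\<And>n. e * norm (G (x n)) < norm (smooth (real n) (S (x n)))"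
    by metis
  have Gx: "norm (G (x n)) > 0" for n
  proof (rule ccontr)
    assume "\<not> norm (G (x n)) > 0"
    then have "x n = 0" using norm_le_norm_G[OF x(1)[of n]] by simp
    then have "S (x n) = 0" using S_scale[OF x(1)[of n], of 0] by simp
    then show False
      using x(2)[of n] norm_smooth_le[of "real n" "0"] \<open>\<not> norm (G (x n)) > 0\<close> by simp
  qed
  \<comment> \<open>Normalising in the graph norm puts all counterexamples into one set whose image
    under \<open>S\<close> is relatively compact.\<close>
  define y where "y n = (1 / norm (G (x n))) *\<^sub>R x n" for n
  have y: "y n \<in> D" for n using x subspace by (simp add: y_def subspace_scale)
  have Gy: "norm (G (y n)) = 1" for n using Gx[of n] x by (simp add: y_def scale)
  have big: "e < norm (smooth (real n) (S (y n)))" for n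
  proof -
    have "smooth (real n) (S (x n)) = norm (G (x n)) *\<^sub>R smooth (real n) (S (y n))"
    proof -
      have "resolv (real n) (S (x n)) = norm (G (x n)) *\<^sub>R resolv (real n) (S (y n))"
      proof (rule resolv_unique)
        have "S (x n) = norm (G (x n)) *\<^sub>R S (y n)"
          using Gx[of n] x by (simp add: y_def S_scale)
        then show "G (norm (G (x n)) *\<^sub>R resolv (real n) (S (y n)))
            + real n *\<^sub>R norm (G (x n)) *\<^sub>R resolv (real n) (S (y n)) = S (x n)"
          using arg_cong[OF G_resolv[of "real n" "S (y n)"], of "(*\<^sub>R) (norm (G (x n)))"]
          by (simp add: scale resolv_in scaleR_add_right mult.commute)
      qed (simp_all add: subspace subspace_scale resolv_in)
      then show ?thesis by (simp add: smooth_def scale resolv_in)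
    qed
    then show ?thesis using x(2)[of n] Gx[of n] by (simp add: mult.commute)
  qed
  have "bounded (range y)"
    by (rule boundedI[of _ 1]) (use norm_le_norm_G[OF y] Gy in auto)
  moreover have "bounded (range (\<lambda>n. G (y n)))"
    by (rule boundedI[of _ 1]) (use Gy in auto)
  ultimately obtain r w where r: "strict_mono (r :: nat \<Rightarrow> nat)" and w: "(\<lambda>n. S (y (r n))) \<longlonglongrightarrow> w"
    using S_compact[of y] y unfolding convergent_def by blast
  \<comment> \<open>Split \<open>S (y (r n))\<close> into its limit \<open>w\<close>, on which the
    smoothing operators tend to 0 strongly, and an error that they do not enlarge.\<close>
  have "(\<lambda>n. norm (S (y (r n)) - w) + norm (smooth (real (r n)) w)) \<longlonglongrightarrow> 0 + 0"
    using w LIMSEQ_subseq_LIMSEQ[OF smooth_tendsto_zero r]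
    by (intro tendsto_add tendsto_norm_zero) (auto simp: LIM_zero o_def)
  then have "\<forall>\<^sub>F n in sequentially. norm (S (y (r n)) - w) + norm (smooth (real (r n)) w) < e"
    using e by (intro order_tendstoD) auto
  then obtain n where n: "norm (S (y (r n)) - w) + norm (smooth (real (r n)) w) < e"
    by (auto simp: eventually_sequentially)
  have "smooth (real (r n)) (S (y (r n))) = smooth (real (r n)) (S (y (r n)) - w) + smooth (real (r n)) w"
    by (simp add: smooth_diff)
  then have "norm (smooth (real (r n)) (S (y (r n)))) \<le> norm (S (y (r n)) - w) + norm (smooth (real (r n)) w)"
    using norm_smooth_le[of "real (r n)" "S (y (r n)) - w"]
      norm_triangle_ineq[of "smooth (real (r n)) (S (y (r n)) - w)" "smooth (real (r n)) w"] by simp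
  then show False using n big[of "r n"] by linarith
qed

text \<open>Lax's bound applied to \<open>M = G^-1 E S E\<close>. Energy symmetry of
  \<open>M\<close> comes from that of \<open>E\<close> and \<open>S\<close>; since \<open>E\<close>
  commutes with \<open>G\<close> and is a contraction, the hypothesis on \<open>E S\<close> controls
  \<open>M\<close> in the graph norm.\<close>

lemma form_smooth_small:
  assumes k: "k > 0" and S_small: "\<And>x. x \<in> D \<Longrightarrow> norm (smooth (real n) (S x)) \<le> k * norm (G x)"
    and x: "x \<in> D"
  shows "\<bar>inner (S (smooth (real n) x)) (smooth (real n) x)\<bar> \<le> k * inner (G x) x"
proof -
  let ?E = "smooth (real n)"
  \<comment> \<open>\<open>resolv 0\<close> is the inverse of \<open>G\<close>.\<close>
  define M where "M x = resolv 0 (?E (S (?E x)))" for x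
  have GM: "G (M x) = ?E (S (?E x))" for x using G_resolv[of 0] by (simp add: M_def)
  have "\<bar>inner (G (M x)) x\<bar> \<le> k * inner (G x) x"
  proof (rule symmetrizable_bound[OF _ _ _ k x])
    show M_in: "M x \<in> D" for x by (simp add: M_def resolv_in)
    show "inner (G (M x)) y = inner (G x) (M y)" if "x \<in> D" "y \<in> D" for x y
    proof -
      have "inner (G x) (M y) = inner x (G (M y))" using that M_in by (intro sym)
      then show ?thesis using that by (simp add: GM smooth_sym S_sym smooth_in)
    qed
    show "norm (G (M x)) \<le> k * norm (G x)" if "x \<in> D" for x
    proof -
      have "norm (G (M x)) \<le> k * norm (G (?E x))"
        using S_small[of "?E x"] smooth_in[of "real n" x] that by (simp add: GM)
      also have "G (?E x) = ?E (G x)" using that by (simp add: smooth_G)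
      also have "k * norm (?E (G x)) \<le> k * norm (G x)"
        using k by (intro mult_left_mono norm_smooth_le) auto
      finally show ?thesis .
    qed
  qed
  then show ?thesis by (simp add: GM smooth_sym)
qed

text \<open>Pairing the difference \<open>x - E x\<close> with the sum \<open>x + E x\<close> gives
  \<open><S x, x> - <S E x, E x>\<close> by symmetry. The differences are bounded in the graph norm,
  so their images under \<open>S\<close> have convergent subsequences, while the sums are weakly
  null.\<close>

lemma form_regular_tendsto_zero:
  assumes x: "\<And>n. x n \<in> D" and bd: "\<And>n. norm (x n) \<le> 1"
    and weak: "\<And>y. (\<lambda>n. inner y (x n)) \<longlonglongrightarrow> 0"
  shows "(\<lambda>n. inner (S (x n - smooth (real m) (x n))) (x n + smooth (real m) (x n))) \<longlonglongrightarrow> 0"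
    (is "?f \<longlonglongrightarrow> 0")
proof (rule tendsto_zero_subseqI)
  let ?E = "smooth (real m)"
  fix r :: "nat \<Rightarrow> nat" assume "strict_mono r"
  define y where "y n = x (r n) - ?E (x (r n))" for n
  have y_eq: "y n = real m *\<^sub>R resolv (real m) (x (r n))" for n by (simp add: y_def smooth_eq)
  have E_bd: "norm (?E (x n)) \<le> 1" for n
    using norm_smooth_le[of "real m" "x n"] bd[of n] by simp
  have "range y \<subseteq> D" using x subspace by (auto simp: y_def subspace_diff smooth_in)
  moreover have "bounded (range y)"
  proof (rule boundedI[of _ 2])
    fix z assume "z \<in> range y"
    then obtain n where "z = x (r n) - ?E (x (r n))" by (auto simp: y_def)
    then show "norm z \<le> 2"
      using bd[of "r n"] E_bd[of "r n"] norm_triangle_ineq4[of "x (r n)" "?E (x (r n))"] by simp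
  qed
  moreover have "bounded (range (\<lambda>n. G (y n)))"
  proof (rule boundedI[of _ "real m"])
    fix z assume "z \<in> range (\<lambda>n. G (y n))"
    then obtain n where "z = G (y n)" by blast
    \<comment> \<open>Since \<open>1 - E = m (G + m)^-1\<close>, applying \<open>G\<close> gives
      \<open>m E\<close>, a bounded operator.\<close>
    then have "z = real m *\<^sub>R ?E (x (r n))" by (simp add: y_eq scale resolv_in smooth_def)
    then show "norm z \<le> real m" using E_bd by (simp add: mult_left_le)
  qed
  ultimately obtain s w where s: "strict_mono (s :: nat \<Rightarrow> nat)" and w: "(\<lambda>n. S (y (s n))) \<longlonglongrightarrow> w"
    using S_compact unfolding convergent_def by blast
  have weak': "(\<lambda>n. inner v (x (r (s n)))) \<longlonglongrightarrow> 0" for v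
    using LIMSEQ_subseq_LIMSEQ[OF weak strict_mono_o[OF \<open>strict_mono r\<close> s]] by (simp add: o_def)
  have "(\<lambda>n. ?f (r (s n))) \<longlonglongrightarrow> 0"
    unfolding y_def[symmetric]
  proof (rule inner_tendsto_zero[OF w])
    have "(\<lambda>n. inner w (x (r (s n))) + inner (?E w) (x (r (s n)))) \<longlonglongrightarrow> 0 + 0"
      by (intro tendsto_add weak')
    then show "(\<lambda>n. inner w (x (r (s n)) + ?E (x (r (s n))))) \<longlonglongrightarrow> 0"
      by (simp add: inner_add_right smooth_sym)
    show "norm (x (r (s n)) + ?E (x (r (s n)))) \<le> 2" for n
      using norm_triangle_ineq[of "x (r (s n))" "?E (x (r (s n)))"] bd[of "r (s n)"] E_bd[of "r (s n)"]
      by linarith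
  qed
  then show "\<exists>s. strict_mono s \<and> (\<lambda>n. ?f (r (s n))) \<longlonglongrightarrow> 0" using s by blast
qed

text \<open>The order of choices matters: first fix \<open>m\<close> so that the part
  \<open><S E x, E x>\<close> is below \<open>e / 2\<close> uniformly on the energy ball, then let
  \<open>n\<close> grow to dispose of the regular part for this \<open>m\<close>.\<close>

lemma form_compact:
  assumes x: "\<And>n. x n \<in> D" and bd: "\<And>n. inner (G (x n)) (x n) \<le> 1"
    and weak: "\<And>y. (\<lambda>n. inner y (x n)) \<longlonglongrightarrow> 0"
  shows "(\<lambda>n. inner (S (x n)) (x n)) \<longlonglongrightarrow> 0"
proof (rule tendstoI)
  fix e :: real assume e: "e > 0"
  obtain m where m: "\<And>x. x \<in> D \<Longrightarrow> norm (smooth (real m) (S x)) \<le> e / 2 * norm (G x)"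
    using smooth_S_small[of "e / 2"] e by auto
  let ?E = "smooth (real m)"
  have "(norm (x n))\<^sup>2 \<le> 1\<^sup>2" for n using coercive[OF x] bd order_trans by fastforce
  then have "norm (x n) \<le> 1" for n by (rule power2_le_imp_le) simp
  then have "\<forall>\<^sub>F n in sequentially. \<bar>inner (S (x n - ?E (x n))) (x n + ?E (x n))\<bar> < e / 2"
    using tendstoD[OF form_regular_tendsto_zero[OF x _ weak], of "e / 2" m] e by simp
  then show "\<forall>\<^sub>F n in sequentially. dist (inner (S (x n)) (x n)) 0 < e"
  proof eventually_elim
    case (elim n)
    have E: "?E (x n) \<in> D" using x by (simp add: smooth_in)
    have "\<bar>inner (S (?E (x n))) (?E (x n))\<bar> \<le> e / 2 * inner (G (x n)) (x n)"
      using e m x by (intro form_smooth_small) auto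
    also have "\<dots> \<le> e / 2 * 1" using e bd by (intro mult_left_mono) auto
    finally have "\<bar>inner (S (?E (x n))) (?E (x n))\<bar> \<le> e / 2" by simp
    moreover have "inner (S (x n)) (x n) =
        inner (S (x n - ?E (x n))) (x n + ?E (x n)) + inner (S (?E (x n))) (?E (x n))"
      using S_sym[OF E x] by (simp add: S_diff x E inner_diff_left inner_add_right
          inner_commute[of "S (x n)" "?E (x n)"])
    ultimately show ?case using elim by simp
  qed
qed

text \<open>Rescale to unit energy and use homogeneity. The energy of a unit vector is at least 1,
  so the scaling factors are at most 1 and preserve weak convergence to 0.\<close>

lemma form_ratio_tendsto_zero:
  assumes x: "\<And>n. x n \<in> D" and nz: "\<And>n. norm (x n) = 1"
    and weak: "\<And>y. (\<lambda>n. inner y (x n)) \<longlonglongrightarrow> 0"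
  shows "(\<lambda>n. inner (S (x n)) (x n) / inner (G (x n)) (x n)) \<longlonglongrightarrow> 0"
proof -
  define q where "q n = inner (G (x n)) (x n)" for n
  have q: "q n \<ge> 1" for n using coercive[OF x, of n] nz by (simp add: q_def)
  then have q0: "q n > 0" for n using zero_less_one less_le_trans by blast
  define t where "t n = 1 / sqrt (q n)" for n
  have t: "0 \<le> t n" "t n \<le> 1" "t n * t n = 1 / q n" for n
    using q[of n] q0[of n] by (simp_all add: t_def)
  have "(\<lambda>n. inner (S (t n *\<^sub>R x n)) (t n *\<^sub>R x n)) \<longlonglongrightarrow> 0"
  proof (rule form_compact)
    show "t n *\<^sub>R x n \<in> D" for n using x subspace by (simp add: subspace_scale)
    show "inner (G (t n *\<^sub>R x n)) (t n *\<^sub>R x n) \<le> 1" for n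
      using x t(3)[of n] q0[of n] by (simp add: scale q_def flip: mult.assoc)
    fix y
    show "(\<lambda>n. inner y (t n *\<^sub>R x n)) \<longlonglongrightarrow> 0"
    proof (rule Lim_null_comparison)
      show "\<forall>\<^sub>F n in sequentially. norm (inner y (t n *\<^sub>R x n)) \<le> \<bar>inner y (x n)\<bar>"
        using t by (simp add: abs_mult mult_left_le_one_le)
    qed (use tendsto_rabs_zero[OF weak] in auto)
  qed
  moreover have "inner (S (t n *\<^sub>R x n)) (t n *\<^sub>R x n) = inner (S (x n)) (x n) / q n" for n
    using x t(3)[of n] by (simp add: S_scale flip: mult.assoc)
  ultimately show ?thesis by (simp add: q_def)
qed

end

end

section \<open>Square roots of bounded operators\<close>

text \<open>Solves \<open>y = (b + y\<^sup>2) / 2\<close> for an operator \<open>b\<close> with norm at most \<open>1\<close>, so that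
  \<open>(1 - y)\<^sup>2 = 1 - b\<close>; the scalar iteration with \<open>b = 1\<close> is a majorant.\<close>

primrec sqrt_iter :: "('a::real_normed_vector \<Rightarrow> 'a) \<Rightarrow> nat \<Rightarrow> 'a \<Rightarrow> 'a" where
  "sqrt_iter B 0 x = 0"
| "sqrt_iter B (Suc n) x = (1/2) *\<^sub>R (B x + sqrt_iter B n (sqrt_iter B n x))"

primrec sqrt_majorant :: "nat \<Rightarrow> real" where
  "sqrt_majorant 0 = 0"
| "sqrt_majorant (Suc n) = (1 + (sqrt_majorant n)\<^sup>2) / 2"

lemma sqrt_majorant_bounds: "0 \<le> sqrt_majorant n \<and> sqrt_majorant n \<le> 1"
proof (induction n)
  case (Suc n)
  then have "(sqrt_majorant n)\<^sup>2 \<le> 1\<^sup>2" by (intro power_mono) auto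
  then show ?case using Suc by simp
qed simp

lemma sqrt_majorant_le_Suc: "sqrt_majorant n \<le> sqrt_majorant (Suc n)"
  using zero_le_power2[of "1 - sqrt_majorant n"] by (simp add: power2_diff)

lemma sqrt_majorant_Cauchy: "Cauchy sqrt_majorant"
proof -
  have "incseq sqrt_majorant" by (rule incseq_SucI) (rule sqrt_majorant_le_Suc)
  moreover have "sqrt_majorant n \<le> 1" for n using sqrt_majorant_bounds by blast
  ultimately obtain L where "sqrt_majorant \<longlonglongrightarrow> L"
    using incseq_convergent by blast
  then show ?thesis using LIMSEQ_imp_Cauchy by blast
qed

lemma bounded_linear_sqrt_iter: "bounded_linear B \<Longrightarrow> bounded_linear (sqrt_iter B n)"
proof (induction n)
  case (Suc n)
  then have "bounded_linear (\<lambda>x. sqrt_iter B n (sqrt_iter B n x))"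
    using bounded_linear_compose by blast
  then have "bounded_linear (\<lambda>x. (1/2) *\<^sub>R (B x + sqrt_iter B n (sqrt_iter B n x)))"
    using Suc by (intro bounded_linear_const_scaleR bounded_linear_add) auto
  then show ?case by (simp add: fun_eq_iff[symmetric] sqrt_iter.simps(2)[abs_def])
qed (simp add: sqrt_iter.simps(1)[abs_def])

lemma norm_sqrt_iter:
  assumes "\<And>x. norm (B x) \<le> norm x"
  shows "norm (sqrt_iter B n x) \<le> sqrt_majorant n * norm x"
proof (induction n arbitrary: x)
  case (Suc n)
  let ?Y = "sqrt_iter B n" and ?y = "sqrt_majorant n"
  have "norm (B x + ?Y (?Y x)) \<le> norm x + ?y * (?y * norm x)"
    using assms Suc.IH[of "?Y x"] mult_left_mono[OF Suc.IH[of x], of ?y] sqrt_majorant_bounds[of n]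
      norm_triangle_ineq[of "B x" "?Y (?Y x)"] by (smt (verit))
  then show ?case by (simp add: power2_eq_square distrib_right mult.assoc add_divide_distrib flip: scaleR_add_right)
qed simp

lemma norm_sqrt_iter_le:
  assumes "\<And>x. norm (B x) \<le> norm x"
  shows "norm (sqrt_iter B n x) \<le> norm x"
  using norm_sqrt_iter[OF assms, of n x] sqrt_majorant_bounds[of n]
    mult_right_mono[of "sqrt_majorant n" 1 "norm x"] by simp

text \<open>For consecutive iterates \<open>Y\<close> and \<open>Z\<close>, write
  \<open>Z Z - Y Y = Z (Z - Y) + (Z - Y) Y\<close>. The estimate of each summand matches a term of
  the same decomposition for the scalar majorant.\<close>

lemma norm_sqrt_iter_Suc_diff:
  assumes B: "bounded_linear B" "\<And>x. norm (B x) \<le> norm x"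
  shows "norm (sqrt_iter B (Suc n) x - sqrt_iter B n x)
    \<le> (sqrt_majorant (Suc n) - sqrt_majorant n) * norm x"
proof (induction n arbitrary: x)
  case 0
  then show ?case using B(2)[of x] by simp
next
  case (Suc n)
  let ?Y = "sqrt_iter B n" and ?Z = "sqrt_iter B (Suc n)"
  let ?y = "sqrt_majorant n" and ?z = "sqrt_majorant (Suc n)"
  have Z: "?Z (?Z x - ?Y x) = ?Z (?Z x) - ?Z (?Y x)"
    by (rule bounded_linear.linear[THEN linear_diff, OF bounded_linear_sqrt_iter[OF B(1)]])
  have yz: "0 \<le> ?y" "0 \<le> ?z" "?y \<le> ?z"
    using sqrt_majorant_bounds sqrt_majorant_le_Suc by blast+
  have "norm (?Z (?Z x - ?Y x)) \<le> ?z * ((?z - ?y) * norm x)"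
    using norm_sqrt_iter[OF B(2), of "Suc n" "?Z x - ?Y x"] mult_left_mono[OF Suc.IH yz(2)]
    by (rule order_trans)
  moreover have "norm (?Z (?Y x) - ?Y (?Y x)) \<le> (?z - ?y) * (?y * norm x)"
    using order_trans[OF Suc.IH[of "?Y x"] mult_left_mono[OF norm_sqrt_iter[OF B(2)]]] yz by simp
  ultimately have "norm (?Z (?Z x - ?Y x) + (?Z (?Y x) - ?Y (?Y x)))
      \<le> ?z * ((?z - ?y) * norm x) + (?z - ?y) * (?y * norm x)"
    by (rule norm_triangle_mono)
  also have "?Z (?Z x - ?Y x) + (?Z (?Y x) - ?Y (?Y x)) = ?Z (?Z x) - ?Y (?Y x)"
    by (simp only: Z) simp
  also have "?Z (?Z x) - ?Y (?Y x) = 2 *\<^sub>R (sqrt_iter B (Suc (Suc n)) x - ?Z x)"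
    unfolding sqrt_iter.simps(2)[of B "Suc n" x] sqrt_iter.simps(2)[of B n x]
    by (simp del: sqrt_iter.simps add: algebra_simps)
  also have "?z * ((?z - ?y) * norm x) + (?z - ?y) * (?y * norm x)
      = 2 * ((sqrt_majorant (Suc (Suc n)) - ?z) * norm x)"
    unfolding sqrt_majorant.simps(2)[of "Suc n"]
    by (subst (5) sqrt_majorant.simps(2)) (simp del: sqrt_majorant.simps add: power2_eq_square algebra_simps)
  finally show ?case by (simp del: sqrt_iter.simps sqrt_majorant.simps)
qed

lemma norm_sqrt_iter_diff:
  assumes B: "bounded_linear B" "\<And>x. norm (B x) \<le> norm x" and "n \<le> m"
  shows "norm (sqrt_iter B m x - sqrt_iter B n x) \<le> (sqrt_majorant m - sqrt_majorant n) * norm x"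
  using \<open>n \<le> m\<close>
proof (induction m rule: dec_induct)
  case (step m)
  have "norm ((sqrt_iter B (Suc m) x - sqrt_iter B m x) + (sqrt_iter B m x - sqrt_iter B n x))
      \<le> (sqrt_majorant (Suc m) - sqrt_majorant m) * norm x + (sqrt_majorant m - sqrt_majorant n) * norm x"
    by (intro norm_triangle_mono norm_sqrt_iter_Suc_diff B step)
  then show ?case by (simp del: sqrt_iter.simps sqrt_majorant.simps add: algebra_simps)
qed simp

text \<open>Every iterate is a polynomial in \<open>B\<close>; the limit thus inherits commutation
  with everything bounded that commutes with \<open>B\<close>.\<close>

lemma sqrt_iter_commute:
  assumes "linear C" "\<And>x. C (B x) = B (C x)"
  shows "C (sqrt_iter B n x) = sqrt_iter B n (C x)"
  by (induction n arbitrary: x)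
    (simp_all add: assms linear_0[OF assms(1)] linear_add[OF assms(1)] linear_scale[OF assms(1)])

lemma sqrt_iter_sym:
  fixes B :: "'a::real_inner \<Rightarrow> 'a"
  assumes "\<And>x y. inner (B x) y = inner x (B y)"
  shows "inner (sqrt_iter B n x) y = inner x (sqrt_iter B n y)"
  by (induction n arbitrary: x y) (simp_all add: assms inner_add_left inner_add_right)

lemma sqrt_iter_convergent:
  fixes B :: "'a::{real_normed_vector,complete_space} \<Rightarrow> 'a"
  assumes B: "bounded_linear B" "\<And>x. norm (B x) \<le> norm x"
  shows "convergent (\<lambda>n. sqrt_iter B n x)"
proof -
  have "Cauchy (\<lambda>n. sqrt_iter B n x)"
  proof (rule metric_CauchyI)
    fix e :: real assume e: "e > 0"
    define d where "d = e / (norm x + 1)"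
    have x1: "norm x + 1 > 0" by (simp add: add_nonneg_pos)
    then have "d > 0" using e by (simp add: d_def)
    then obtain N where N: "\<And>m n. m \<ge> N \<Longrightarrow> n \<ge> N \<Longrightarrow> dist (sqrt_majorant m) (sqrt_majorant n) < d"
      using metric_CauchyD[OF sqrt_majorant_Cauchy] by metis
    have le: "dist (sqrt_iter B m x) (sqrt_iter B n x) < e" if "m \<ge> n" "n \<ge> N" for m n
    proof -
      have "dist (sqrt_iter B m x) (sqrt_iter B n x) \<le> (sqrt_majorant m - sqrt_majorant n) * norm x"
        using norm_sqrt_iter_diff[OF B that(1)] by (simp add: dist_norm)
      also have "\<dots> \<le> d * norm x"
        using N[of m n] that by (intro mult_right_mono) (auto simp: dist_real_def)
      also have "\<dots> < d * (norm x + 1)" using \<open>d > 0\<close> by simp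
      also have "\<dots> = e" using x1 by (simp add: d_def)
      finally show ?thesis .
    qed
    show "\<exists>N. \<forall>m\<ge>N. \<forall>n\<ge>N. dist (sqrt_iter B m x) (sqrt_iter B n x) < e"
    proof (intro exI allI impI)
      fix m n assume "m \<ge> N" "n \<ge> N"
      then show "dist (sqrt_iter B m x) (sqrt_iter B n x) < e"
        using le[of n m] le[of m n] by (cases "m \<ge> n") (auto simp: dist_commute)
    qed
  qed
  then show ?thesis by (rule Cauchy_convergent)
qed

text \<open>For symmetric \<open>A\<close> the last hypothesis expresses that \<open>A\<close> lies
  between 0 and 1, and expanding a square turns it into a norm bound for \<open>1 - A\<close>. The
  root is \<open>1 - Y\<close> with \<open>Y\<close> the limit of the iteration. The commutation
  clause later gives uniqueness and complex linearity.\<close>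

lemma bounded_operator_sqrt:
  fixes A :: "'a::{real_inner,complete_space} \<Rightarrow> 'a"
  assumes A: "bounded_linear A" and A_sym: "\<And>x y. inner (A x) y = inner x (A y)"
    and A_le: "\<And>x. (norm (A x))\<^sup>2 \<le> inner (A x) x"
  obtains P where "bounded_linear P" "\<forall>x y. inner (P x) y = inner x (P y)"
    "\<forall>x. 0 \<le> inner (P x) x" "\<forall>x. P (P x) = A x"
    "\<forall>C. bounded_linear C \<longrightarrow> (\<forall>x. C (A x) = A (C x)) \<longrightarrow> (\<forall>x. C (P x) = P (C x))"
proof -
  define B where "B x = x - A x" for x
  have B: "bounded_linear B"
    unfolding B_def[abs_def] by (intro bounded_linear_sub bounded_linear_ident A)
  have B_sym: "inner (B x) y = inner x (B y)" for x y
    by (simp add: B_def inner_diff_left inner_diff_right A_sym)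
  have B_le: "norm (B x) \<le> norm x" for x
  proof -
    have "(norm (B x))\<^sup>2 = (norm x)\<^sup>2 - 2 * inner (A x) x + (norm (A x))\<^sup>2"
      by (simp add: B_def power2_norm_eq_inner inner_diff_left inner_diff_right inner_commute)
    then have "(norm (B x))\<^sup>2 \<le> (norm x)\<^sup>2"
      using A_le[of x] zero_le_power2[of "norm (A x)"] by linarith
    then show ?thesis by (rule power2_le_imp_le) simp
  qed
  let ?Y = "sqrt_iter B"
  define Y where "Y x = lim (\<lambda>n. ?Y n x)" for x
  have Y: "(\<lambda>n. ?Y n x) \<longlonglongrightarrow> Y x" for x
    using sqrt_iter_convergent[OF B B_le] by (simp add: Y_def convergent_LIMSEQ_iff)
  have Yn: "bounded_linear (?Y n)" for n by (rule bounded_linear_sqrt_iter[OF B])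
  have Y_le: "norm (Y x) \<le> norm x" for x
    by (rule LIMSEQ_le_const2[OF tendsto_norm[OF Y]]) (use norm_sqrt_iter_le[OF B_le] in blast)
  have Y_lin: "bounded_linear Y"
  proof (rule bounded_linear_intro[where K = 1])
    show "Y (x + y) = Y x + Y y" for x y
    proof (rule LIMSEQ_unique[OF Y])
      show "(\<lambda>n. ?Y n (x + y)) \<longlonglongrightarrow> Y x + Y y"
        using tendsto_add[OF Y Y] by (simp add: bounded_linear.linear[OF Yn] linear_add)
    qed
    show "Y (r *\<^sub>R x) = r *\<^sub>R Y x" for r x
    proof (rule LIMSEQ_unique[OF Y])
      show "(\<lambda>n. ?Y n (r *\<^sub>R x)) \<longlonglongrightarrow> r *\<^sub>R Y x"
        using tendsto_scaleR[OF tendsto_const Y] by (simp add: bounded_linear.linear[OF Yn] linear_scale)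
    qed
  qed (simp add: Y_le)
  have Y_sym: "inner (Y x) y = inner x (Y y)" for x y
  proof (rule LIMSEQ_unique)
    show "(\<lambda>n. inner (?Y n x) y) \<longlonglongrightarrow> inner (Y x) y" by (intro tendsto_intros Y)
    show "(\<lambda>n. inner (?Y n x) y) \<longlonglongrightarrow> inner x (Y y)"
      unfolding sqrt_iter_sym[OF B_sym] by (intro tendsto_intros Y)
  qed
  \<comment> \<open>Both factors vary with \<open>n\<close>: the inner one is replaced by its limit
    using that all iterates are contractions.\<close>
  have YY: "(\<lambda>n. ?Y n (?Y n x)) \<longlonglongrightarrow> Y (Y x)" for x
  proof -
    have "(\<lambda>n. ?Y n (?Y n x - Y x)) \<longlonglongrightarrow> 0"
    proof (rule Lim_null_comparison)
      show "\<forall>\<^sub>F n in sequentially. norm (?Y n (?Y n x - Y x)) \<le> norm (?Y n x - Y x)"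
        by (simp add: norm_sqrt_iter_le[OF B_le])
      show "(\<lambda>n. norm (?Y n x - Y x)) \<longlonglongrightarrow> 0" using Y by (simp add: LIM_zero tendsto_norm_zero)
    qed
    from tendsto_add[OF this Y[of "Y x"]] show ?thesis
      by (simp add: bounded_linear.linear[OF Yn] linear_diff)
  qed
  have fix_eq: "Y x = (1/2) *\<^sub>R (B x + Y (Y x))" for x
  proof (rule LIMSEQ_unique[OF LIMSEQ_Suc[OF Y]])
    show "(\<lambda>n. ?Y (Suc n) x) \<longlonglongrightarrow> (1/2) *\<^sub>R (B x + Y (Y x))"
      unfolding sqrt_iter.simps by (intro tendsto_intros YY)
  qed
  show ?thesis
  proof
    show "bounded_linear (\<lambda>x. x - Y x)" by (intro bounded_linear_sub bounded_linear_ident Y_lin)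
    show "\<forall>x y. inner (x - Y x) y = inner x (y - Y y)"
      by (simp add: inner_diff_left inner_diff_right Y_sym)
    show "\<forall>x. 0 \<le> inner (x - Y x) x"
    proof
      fix x
      have "inner (Y x) x \<le> norm x * norm x"
        using norm_cauchy_schwarz[of "Y x" x] mult_right_mono[OF Y_le[of x], of "norm x"] by simp
      then show "0 \<le> inner (x - Y x) x" by (simp add: inner_diff_left dot_square_norm power2_eq_square)
    qed
    show "\<forall>x. x - Y x - Y (x - Y x) = A x"
    proof
      fix x
      have 1: "2 *\<^sub>R Y x = B x + Y (Y x)" by (subst fix_eq) simp
      have 2: "Y (x - Y x) = Y x - Y (Y x)"
        by (simp add: bounded_linear.linear[OF Y_lin] linear_diff)
      show "x - Y x - Y (x - Y x) = A x" unfolding 2 using 1 by (simp add: B_def scaleR_2 algebra_simps)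
    qed
    show "\<forall>C. bounded_linear C \<longrightarrow> (\<forall>x. C (A x) = A (C x)) \<longrightarrow>
        (\<forall>x. C (x - Y x) = C x - Y (C x))"
    proof (intro allI impI)
      fix C x assume C: "bounded_linear C" and comm: "\<forall>x. C (A x) = A (C x)"
      have "C (B x) = B (C x)" for x
        by (simp add: B_def comm bounded_linear.linear[OF C] linear_diff)
      then have "C (?Y n x) = ?Y n (C x)" for n
        by (intro sqrt_iter_commute bounded_linear.linear[OF C])
      then have "C (Y x) = Y (C x)"
        using bounded_linear.tendsto[OF C Y[of x]] Y[of "C x"] LIMSEQ_unique by simp
      then show "C (x - Y x) = C x - Y (C x)" by (simp add: bounded_linear.linear[OF C] linear_diff)
    qed
  qed
qed

section \<open>Operators in complex Hilbert spaces\<close>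

lemma cinner_add_right: "cinner x (y + z) = cinner x y + cinner x z"
  by (metis cinner_add_left cinner_commute complex_cnj_add)

lemma cinner_scaleC_right: "cinner x (c *\<^sub>C y) = cnj c * cinner x y"
  by (metis cinner_scaleC_left cinner_commute complex_cnj_mult)

lemma Im_cinner: "Im (cinner x y) = - inner (\<i> *\<^sub>C x) y"
  by (simp add: cinner_scaleC_left flip: Re_cinner)

lemma norm_scaleC: "norm (c *\<^sub>C (x::'a::chilbert_space)) = cmod c * norm x"
proof -
  have im: "Im (cinner x x) = 0"
    using arg_cong[OF cinner_commute[of x x], of Im] by simp
  have "(norm (c *\<^sub>C x))\<^sup>2 = Re (cinner (c *\<^sub>C x) (c *\<^sub>C x))"
    by (simp add: power2_norm_eq_inner Re_cinner)
  also have "cinner (c *\<^sub>C x) (c *\<^sub>C x) = complex_of_real ((cmod c)\<^sup>2) * cinner x x"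
    by (simp add: cinner_scaleC_left cinner_scaleC_right complex_norm_square ac_simps del: of_real_power)
  also have "Re \<dots> = (cmod c)\<^sup>2 * (norm x)\<^sup>2"
    by (simp add: Re_cinner power2_norm_eq_inner)
  finally have "(norm (c *\<^sub>C x))\<^sup>2 = (cmod c * norm x)\<^sup>2" by (simp add: power_mult_distrib)
  then show ?thesis by (simp add: power2_eq_iff_nonneg)
qed

lemma bounded_bilinear_cinner: "bounded_bilinear (cinner :: 'a::chilbert_space \<Rightarrow> 'a \<Rightarrow> complex)"
proof
  fix a a' b b' :: 'a and r :: real
  show "cinner (a + a') b = cinner a b + cinner a' b" by (rule cinner_add_left)
  show "cinner a (b + b') = cinner a b + cinner a b'" by (rule cinner_add_right)
  show "cinner (r *\<^sub>R a) b = r *\<^sub>R cinner a b"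
    by (simp add: cinner_scaleC_left scaleR_conv_of_real flip: scaleC_of_real)
  show "cinner a (r *\<^sub>R b) = r *\<^sub>R cinner a b"
    by (simp add: cinner_scaleC_right scaleR_conv_of_real flip: scaleC_of_real)
  show "\<exists>K. \<forall>a b::'a. norm (cinner a b) \<le> norm a * norm b * K"
  proof (intro exI allI)
    fix a b :: 'a
    have "norm (cinner a b) \<le> \<bar>inner a b\<bar> + \<bar>inner (\<i> *\<^sub>C a) b\<bar>"
      using cmod_le[of "cinner a b"] by (simp add: Re_cinner Im_cinner)
    also have "\<dots> \<le> norm a * norm b + norm (\<i> *\<^sub>C a) * norm b"
      by (intro add_mono Cauchy_Schwarz_ineq2)
    finally show "norm (cinner a b) \<le> norm a * norm b * 2" by (simp add: norm_scaleC)
  qed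
qed

lemmas tendsto_cinner = bounded_bilinear.tendsto[OF bounded_bilinear_cinner]

lemma bounded_linear_scaleC: "bounded_linear ((*\<^sub>C) c :: 'a \<Rightarrow> 'a::chilbert_space)"
  by (rule bounded_linear_intro[where K = "cmod c"])
    (simp_all add: scaleC_add_right scaleC_scaleC norm_scaleC ac_simps flip: scaleC_of_real)

text \<open>The multipliers 1 and \<open>\<i>\<close> recover real and imaginary part. Real-linear
  arguments are lifted to the complex inner product in this way.\<close>

lemma cinner_eq_of_inner:
  assumes "\<And>c. inner (c *\<^sub>C x) y = inner (c *\<^sub>C x') y'"
  shows "cinner x y = cinner x' y'"
  using assms[of 1] assms[of \<i>] scaleC_of_real[of 1 x] scaleC_of_real[of 1 x']
  by (simp add: complex_eq_iff Re_cinner Im_cinner)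

lemma eq_of_inner_eq_dense:
  fixes z z' :: "'a::real_inner"
  assumes "closure D = UNIV" and "\<And>x. x \<in> D \<Longrightarrow> inner x z = inner x z'"
  shows "z = z'"
proof -
  have "closed {x. inner x z = inner x z'}"
    by (intro closed_Collect_eq continuous_intros)
  then have "closure D \<subseteq> {x. inner x z = inner x z'}"
    using assms(2) by (intro closure_minimal) auto
  then have "inner (z - z') z = inner (z - z') z'" using assms(1) by auto
  then have "inner (z - z') (z - z') = 0" by (simp add: inner_diff_right)
  then show ?thesis by simp
qed

lemma linear_opD:
  assumes "linear_op T"
  shows "\<And>x y. x \<in> dom T \<Longrightarrow> y \<in> dom T \<Longrightarrow> T (x + y) = Some (the (T x) + the (T y))"
    and "\<And>c x. x \<in> dom T \<Longrightarrow> T (c *\<^sub>C x) = Some (c *\<^sub>C the (T x))"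
    and "\<And>r x. x \<in> dom T \<Longrightarrow> T (r *\<^sub>R x) = Some (r *\<^sub>R the (T x))"
    and "subspace (dom T)"
proof -
  show *: "\<And>x y. x \<in> dom T \<Longrightarrow> y \<in> dom T \<Longrightarrow> T (x + y) = Some (the (T x) + the (T y))"
    "\<And>c x. x \<in> dom T \<Longrightarrow> T (c *\<^sub>C x) = Some (c *\<^sub>C the (T x))"
    using assms by (auto simp: linear_op_def)
  show **: "\<And>r x. x \<in> dom T \<Longrightarrow> T (r *\<^sub>R x) = Some (r *\<^sub>R the (T x))"
    using *(2) by (simp flip: scaleC_of_real)
  show "subspace (dom T)"
  proof (rule subspaceI)
    show "0 \<in> dom T" using assms by (simp add: linear_op_def)
    show "x + y \<in> dom T" if "x \<in> dom T" "y \<in> dom T" for x y using *(1)[OF that] by blast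
    show "r *\<^sub>R x \<in> dom T" if "x \<in> dom T" for r x using **[OF that] by blast
  qed
qed

text \<open>Density makes the representing vector unique, so the definite description in the
  definition returns it.\<close>

lemma op_adjoint_eq_Some_iff:
  assumes "closure (dom T) = UNIV"
  shows "op_adjoint T y = Some z \<longleftrightarrow> (\<forall>x\<in>dom T. cinner (the (T x)) y = cinner x z)"
proof -
  let ?P = "\<lambda>z. \<forall>x\<in>dom T. cinner (the (T x)) y = cinner x z"
  have uniq: "z = z'" if "?P z" "?P z'" for z z'
    using that by (intro eq_of_inner_eq_dense[OF assms]) (simp flip: Re_cinner)
  show ?thesis
  proof (cases "\<exists>z. ?P z")
    case True
    then have "?P (The ?P)" using theI'[of ?P] uniq by blast
    then have "The ?P = z \<longleftrightarrow> ?P z" using uniq by blast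
    moreover have "op_adjoint T y = Some (The ?P)" using True by (simp only: op_adjoint_def if_True)
    ultimately show ?thesis by (simp only: option.inject)
  next
    case False
    then have "op_adjoint T y = None" by (simp only: op_adjoint_def if_False)
    then show ?thesis using False by auto
  qed
qed

lemma selfadjoint_op_eq_Some_iff:
  assumes "selfadjoint_op T"
  shows "T y = Some z \<longleftrightarrow> (\<forall>x\<in>dom T. cinner (the (T x)) y = cinner x z)"
  using assms op_adjoint_eq_Some_iff[of T y z] by (simp add: selfadjoint_op_def)

lemma selfadjoint_op_symmetric:
  assumes "selfadjoint_op T" shows "symmetric_op T"
  unfolding symmetric_op_def
proof (intro conjI ballI)
  show "linear_op T" using assms by (simp add: selfadjoint_op_def)
  fix x y assume x: "x \<in> dom T" and "y \<in> dom T"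
  then obtain z where z: "T y = Some z" by blast
  then have "\<forall>x\<in>dom T. cinner (the (T x)) y = cinner x z"
    using selfadjoint_op_eq_Some_iff[OF assms] by blast
  then show "cinner (the (T x)) y = cinner x (the (T y))" using x z by simp
qed

lemma symmetric_op_inner:
  assumes "symmetric_op T" "x \<in> dom T" "y \<in> dom T"
  shows "inner (the (T x)) y = inner x (the (T y))"
  using assms by (simp add: symmetric_op_def flip: Re_cinner)

lemma symmetric_op_cinner_self:
  assumes "symmetric_op T" "x \<in> dom T"
  shows "cinner (the (T x)) x = complex_of_real (inner (the (T x)) x)"
proof -
  have "cinner (the (T x)) x = cnj (cinner (the (T x)) x)"
    using assms cinner_commute[of x "the (T x)"] by (simp add: symmetric_op_def)
  from arg_cong[OF this, of Im] show ?thesis by (simp add: complex_eq_iff Re_cinner)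
qed

text \<open>The range is closed, by the lower bound and the closedness of a selfadjoint operator. A
  vector orthogonal to it lies in the domain of the adjoint, hence in \<open>dom T\<close>, and is
  annihilated by \<open>s T + l\<close>, so coercivity makes it 0.\<close>

lemma selfadjoint_op_surj:
  assumes T: "selfadjoint_op T" and s: "s \<noteq> 0" and c: "c > 0"
    and coercive: "\<And>x. x \<in> dom T \<Longrightarrow> c * (norm x)\<^sup>2 \<le> inner (s *\<^sub>R the (T x) + l *\<^sub>R x) x"
  shows "\<exists>x\<in>dom T. s *\<^sub>R the (T x) + l *\<^sub>R x = y"
proof -
  define G where "G x = s *\<^sub>R the (T x) + l *\<^sub>R x" for x
  have lin: "linear_op T" and dense: "closure (dom T) = UNIV"
    using T by (auto simp: selfadjoint_op_def)
  note L = linear_opD[OF lin]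
  have sub: "subspace (G ` dom T)"
  proof (rule subspaceI)
    have "0 \<in> dom T" using L(4) by (rule subspace_0)
    moreover have "G 0 = 0" using L(3)[OF \<open>0 \<in> dom T\<close>, of 0] by (simp add: G_def)
    ultimately show "0 \<in> G ` dom T" by force
  next
    fix a b assume "a \<in> G ` dom T" "b \<in> G ` dom T"
    then obtain x y where "x \<in> dom T" "y \<in> dom T" "a = G x" "b = G y" by blast
    moreover from this have "a + b = G (x + y)" by (simp add: G_def L(1) algebra_simps)
    ultimately show "a + b \<in> G ` dom T" using subspace_add[OF L(4)] by blast
  next
    fix r a assume "a \<in> G ` dom T"
    then obtain x where "x \<in> dom T" "a = G x" by blast
    moreover from this have "r *\<^sub>R a = G (r *\<^sub>R x)" by (simp add: G_def L(3) algebra_simps)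
    ultimately show "r *\<^sub>R a \<in> G ` dom T" using subspace_scale[OF L(4)] by blast
  qed
  have below: "c * norm x \<le> norm (G x)" if "x \<in> dom T" for x
  proof (cases "x = 0")
    case False
    have "(c * norm x) * norm x \<le> norm (G x) * norm x"
      using coercive[OF that] norm_cauchy_schwarz[of "G x" x] by (simp add: G_def power2_eq_square)
    then show ?thesis using False by simp
  qed simp
  have "closed (G ` dom T)"
    unfolding closed_sequential_limits
  proof (intro allI impI, elim conjE)
    fix g w assume g: "\<forall>n. g n \<in> G ` dom T" and w: "g \<longlonglongrightarrow> w"
    define x where "x n = (SOME x. x \<in> dom T \<and> g n = G x)" for n
    have "x n \<in> dom T \<and> g n = G (x n)" for n
      unfolding x_def by (rule someI_ex) (use g in blast)
    then have x: "\<And>n. x n \<in> dom T" "\<And>n. g n = G (x n)" by blast+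
    have diff: "G (x m - x n) = g m - g n" for m n
      using L(1)[OF x(1)[of m] subspace_scale[OF L(4) x(1)[of n], of "-1"]] L(3)[OF x(1)[of n], of "-1"]
      by (simp add: G_def x(2) algebra_simps)
    have "Cauchy x"
    proof (rule metric_CauchyI)
      fix e :: real assume "e > 0"
      then have "c * e > 0" using c by simp
      then obtain N where N: "\<And>m n. m \<ge> N \<Longrightarrow> n \<ge> N \<Longrightarrow> dist (g m) (g n) < c * e"
        using metric_CauchyD[OF LIMSEQ_imp_Cauchy[OF w]] by metis
      have "dist (x m) (x n) < e" if "m \<ge> N" "n \<ge> N" for m n
      proof -
        have "c * norm (x m - x n) < c * e"
          using below[of "x m - x n"] subspace_diff[OF L(4) x(1) x(1)] N[OF that]
          by (force simp: diff dist_norm)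
        then show ?thesis using c by (simp add: dist_norm)
      qed
      then show "\<exists>N. \<forall>m\<ge>N. \<forall>n\<ge>N. dist (x m) (x n) < e" by blast
    qed
    then obtain v where v: "x \<longlonglongrightarrow> v" using Cauchy_convergent convergent_def by blast
    define z where "z = (1 / s) *\<^sub>R (w - l *\<^sub>R v)"
    have "(\<lambda>n. (1 / s) *\<^sub>R (g n - l *\<^sub>R x n)) \<longlonglongrightarrow> z"
      unfolding z_def by (intro tendsto_intros w v)
    then have Tx: "(\<lambda>n. the (T (x n))) \<longlonglongrightarrow> z" using s by (simp add: x(2) G_def)
    \<comment> \<open>Closedness of \<open>T\<close>: the relation defining the adjoint survives the
      limit of \<open>x n\<close> and \<open>T (x n)\<close>.\<close>
    have "T v = Some z"
      unfolding selfadjoint_op_eq_Some_iff[OF T]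
    proof
      fix u assume u: "u \<in> dom T"
      have "(\<lambda>n. cinner (the (T u)) (x n)) \<longlonglongrightarrow> cinner (the (T u)) v"
        by (intro tendsto_cinner v tendsto_const)
      moreover have "(\<lambda>n. cinner (the (T u)) (x n)) \<longlonglongrightarrow> cinner u z"
        using tendsto_cinner[OF tendsto_const Tx, of u] selfadjoint_op_symmetric[OF T] u x(1)
        by (simp add: symmetric_op_def)
      ultimately show "cinner (the (T u)) v = cinner u z" by (rule LIMSEQ_unique)
    qed
    then have "v \<in> dom T" "w = G v" using s by (auto simp: G_def z_def)
    then show "w \<in> G ` dom T" by blast
  qed
  have "G ` dom T = UNIV"
  proof (rule ccontr)
    assume ne: "G ` dom T \<noteq> UNIV"
    obtain v where v: "v \<noteq> 0" and "\<forall>w\<in>G ` dom T. inner w v = 0"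
      by (rule closed_subspace_orthogonal[OF sub \<open>closed (G ` dom T)\<close> ne])
    then have orth: "inner (G x) v = 0" if "x \<in> dom T" for x using that by simp
    have "T v = Some ((- l / s) *\<^sub>R v)"
      unfolding selfadjoint_op_eq_Some_iff[OF T]
    proof
      fix u assume u: "u \<in> dom T"
      show "cinner (the (T u)) v = cinner u ((- l / s) *\<^sub>R v)"
      proof (rule cinner_eq_of_inner)
        fix a
        \<comment> \<open>Orthogonality is known only for the real inner product; testing it on all
          complex multiples of \<open>u\<close> gives the complex adjoint relation.\<close>
        have "T (a *\<^sub>C u) = Some (a *\<^sub>C the (T u))" using u by (rule L(2))
        then have "s * inner (a *\<^sub>C the (T u)) v + l * inner (a *\<^sub>C u) v = 0"
          using orth[of "a *\<^sub>C u"] by (force simp: G_def inner_add_left)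
        then show "inner (a *\<^sub>C the (T u)) v = inner (a *\<^sub>C u) ((- l / s) *\<^sub>R v)"
          using s by (simp add: field_simps)
      qed
    qed
    then have "v \<in> dom T" "G v = 0" using s by (auto simp: G_def)
    then have "c * (norm v)\<^sup>2 \<le> 0" using coercive[of v] by (simp add: G_def)
    then show False using v c by (simp add: mult_le_0_iff)
  qed
  then have "y \<in> G ` dom T" by simp
  then show ?thesis unfolding G_def by blast
qed

text \<open>The sign \<open>s\<close> reduces semiboundedness from above to semiboundedness from
  below, and the shift \<open>l\<close> then raises the bound to 1.\<close>

lemma semibounded_coercive_operator:
  assumes T: "selfadjoint_op T" and "semibounded_op T"
  obtains s l :: real where "s = 1 \<or> s = -1" "l > 0"
    "coercive_operator (dom T) (\<lambda>x. s *\<^sub>R the (T x) + l *\<^sub>R x)"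
proof -
  obtain s c :: real where s: "s = 1 \<or> s = -1"
    and c: "\<And>x. x \<in> dom T \<Longrightarrow> c * (norm x)\<^sup>2 \<le> s * inner (the (T x)) x"
  proof -
    from \<open>semibounded_op T\<close> consider c where "bounded_below_by T c" | c where "bounded_above_by T c"
      unfolding semibounded_op_def by blast
    then show thesis
    proof cases
      case 1
      then show thesis using that[of 1 c] by (simp add: bounded_below_by_def Re_cinner)
    next
      case 2
      then show thesis using that[of "-1" "-c"] by (simp add: bounded_above_by_def Re_cinner)
    qed
  qed
  \<comment> \<open>This gives both \<open>c + l >= 1\<close> and \<open>l > 0\<close>.\<close>
  define l where "l = \<bar>c\<bar> + 1"
  have lin: "linear_op T" using T by (simp add: selfadjoint_op_def)
  note L = linear_opD[OF lin]
  have coercive: "(norm x)\<^sup>2 \<le> inner (s *\<^sub>R the (T x) + (l + r) *\<^sub>R x) x"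
    if "x \<in> dom T" "r \<ge> 0" for x r
  proof -
    have "(norm x)\<^sup>2 \<le> c * (norm x)\<^sup>2 + (l + r) * (norm x)\<^sup>2"
      using mult_right_mono[of 1 "c + (l + r)" "(norm x)\<^sup>2"] that(2) by (simp add: l_def distrib_right)
    also have "\<dots> \<le> s * inner (the (T x)) x + (l + r) * (norm x)\<^sup>2" using c[OF that(1)] by simp
    finally show ?thesis by (simp add: inner_add_left power2_norm_eq_inner)
  qed
  have "coercive_operator (dom T) (\<lambda>x. s *\<^sub>R the (T x) + l *\<^sub>R x)"
  proof
    show "subspace (dom T)" by (rule L(4))
  next
    fix x y assume xy: "x \<in> dom T" "y \<in> dom T"
    then show "s *\<^sub>R the (T (x + y)) + l *\<^sub>R (x + y) =
        s *\<^sub>R the (T x) + l *\<^sub>R x + (s *\<^sub>R the (T y) + l *\<^sub>R y)"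
      by (simp add: L(1) algebra_simps)
    show "inner (s *\<^sub>R the (T x) + l *\<^sub>R x) y = inner x (s *\<^sub>R the (T y) + l *\<^sub>R y)"
      using symmetric_op_inner[OF selfadjoint_op_symmetric[OF T] xy]
      by (simp add: inner_add_left inner_add_right)
  next
    fix x and r :: real assume "x \<in> dom T"
    then show "s *\<^sub>R the (T (r *\<^sub>R x)) + l *\<^sub>R r *\<^sub>R x = r *\<^sub>R (s *\<^sub>R the (T x) + l *\<^sub>R x)"
      by (simp add: L(3) algebra_simps)
  next
    fix x assume "x \<in> dom T"
    then show "(norm x)\<^sup>2 \<le> inner (s *\<^sub>R the (T x) + l *\<^sub>R x) x" using coercive[of x 0] by simp
  next
    fix r :: real and y assume "r \<ge> 0"
    then show "\<exists>x\<in>dom T. s *\<^sub>R the (T x) + l *\<^sub>R x + r *\<^sub>R x = y"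
      using selfadjoint_op_surj[OF T, of s 1 "l + r" y] coercive s
      by (force simp: scaleR_add_left add.assoc)
  qed
  then show thesis using that[of s l] s by (simp add: l_def)
qed

section \<open>The square root of a uniformly positive operator\<close>

lemma scaleC_conv_scaleR: "c *\<^sub>C x = Re c *\<^sub>R x + Im c *\<^sub>R (\<i> *\<^sub>C x)"
proof -
  have "c = complex_of_real (Re c) + complex_of_real (Im c) * \<i>" by (simp add: complex_eq_iff)
  then have "c *\<^sub>C x = (complex_of_real (Re c) + complex_of_real (Im c) * \<i>) *\<^sub>C x" by simp
  also have "\<dots> = Re c *\<^sub>R x + Im c *\<^sub>R (\<i> *\<^sub>C x)"
    by (simp only: scaleC_add_left scaleC_scaleC[symmetric] scaleC_of_real)
  finally show ?thesis .
qed

lemma scaleC_linear: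
  assumes "linear P" and "\<And>x. P (\<i> *\<^sub>C x) = \<i> *\<^sub>C P x"
  shows "P (c *\<^sub>C x) = c *\<^sub>C P x"
  by (simp add: scaleC_conv_scaleR[of c] linear_add[OF assms(1)] linear_scale[OF assms(1)] assms(2))

lemma cinner_sym_of_inner:
  assumes "linear P" and "\<And>x. P (\<i> *\<^sub>C x) = \<i> *\<^sub>C P x"
    and sym: "\<And>x y. inner (P x) y = inner x (P y)"
  shows "cinner (P x) y = cinner x (P y)"
  by (rule cinner_eq_of_inner) (simp add: sym flip: scaleC_linear[OF assms(1,2)])

text \<open>The last hypothesis makes \<open>R\<close> the inverse of \<open>P\<close>. Testing the
  adjoint relation on \<open>range P\<close> and moving \<open>P\<close> across reduces it to
  \<open><u, y> = <u, P z>\<close> for all \<open>u\<close>, that is, to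
  \<open>y = P z\<close>.\<close>

lemma selfadjoint_op_inverse:
  assumes P: "linear P" and P_sym: "\<And>x y. cinner (P x) y = cinner x (P y)"
    and P_scaleC: "\<And>c x. P (c *\<^sub>C x) = c *\<^sub>C P x"
    and dense: "closure (range P) = UNIV"
    and R: "\<And>x u. R x = Some u \<longleftrightarrow> x = P u"
  shows "selfadjoint_op R"
proof -
  have R_P: "R (P u) = Some u" for u using R by blast
  have dom_R: "dom R = range P" using R by (auto simp: dom_def)
  have "linear_op R"
    unfolding linear_op_def dom_R
  proof (intro conjI ballI allI; (elim rangeE)?)
    show "0 \<in> range P" using linear_0[OF P] by (metis rangeI)
    show "R (x + y) = Some (the (R x) + the (R y))" if "x = P u" "y = P v" for x y u v
      using that by (simp add: R_P R linear_add[OF P])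
    show "R (c *\<^sub>C x) = Some (c *\<^sub>C the (R x))" if "x = P u" for c x u
      using that by (simp add: R_P R P_scaleC)
  qed
  moreover have "op_adjoint R = R"
  proof
    fix y
    have "op_adjoint R y = Some z \<longleftrightarrow> R y = Some z" for z
    proof -
      have "op_adjoint R y = Some z \<longleftrightarrow> (\<forall>u. cinner u y = cinner u (P z))"
        using dense by (subst op_adjoint_eq_Some_iff) (simp_all add: dom_R R_P P_sym)
      also have "\<dots> \<longleftrightarrow> y = P z"
        using eq_of_inner_eq_dense[of UNIV y "P z"] by (auto simp flip: Re_cinner)
      finally show ?thesis by (simp add: R)
    qed
    then show "op_adjoint R y = R y" by (metis option.exhaust)
  qed
  ultimately show ?thesis using dense by (simp add: selfadjoint_op_def dom_R)
qed

text \<open>Cauchy-Schwarz for the form of \<open>Q\<close>, applied to \<open>w\<close> and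
  \<open>Q w\<close>.\<close>

lemma nonneg_form_zero:
  fixes Q :: "'a::real_inner \<Rightarrow> 'a"
  assumes Q: "linear Q" and "\<And>x y. inner (Q x) y = inner x (Q y)" and "\<And>x. 0 \<le> inner (Q x) x"
    and "inner (Q w) w = 0"
  shows "Q w = 0"
proof -
  have "(inner (Q w) (Q w))\<^sup>2 \<le> inner (Q w) w * inner (Q (Q w)) (Q w)"
    by (rule form_Cauchy_Schwarz[of UNIV]) (use assms in \<open>simp_all add: linear_add linear_scale\<close>)
  then show ?thesis using assms(4) by simp
qed

text \<open>A nonnegative square root of \<open>T\<close> has a bounded inverse \<open>Q\<close> with \<open>Q\<^sup>2 = A\<close>, which commutes
  with \<open>P\<close>; hence \<open>(P + Q) (P - Q) = 0\<close>, and both forms vanish on the range of \<open>P - Q\<close>.\<close>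

lemma nonneg_sqrt_unique:
  assumes A: "bounded_linear A" and T: "\<And>x u. T x = Some u \<longleftrightarrow> x = A u"
    and P: "linear P" and P_sym: "\<And>x y. inner (P x) y = inner x (P y)"
    and P_nonneg: "\<And>x. 0 \<le> inner (P x) x" and PP: "\<And>x. P (P x) = A x"
    and P_comm: "\<And>C x. bounded_linear C \<Longrightarrow> (\<And>x. C (A x) = A (C x)) \<Longrightarrow> C (P x) = P (C x)"
    and R: "selfadjoint_op R" "bounded_below_by R 0" "R \<circ>\<^sub>m R = T"
  shows "R x = Some u \<longleftrightarrow> x = P u"
proof -
  have lin: "linear_op R" using R(1) by (simp add: selfadjoint_op_def)
  note L = linear_opD[OF lin]
  have RR: "T x = Some w \<longleftrightarrow> (\<exists>v. R x = Some v \<and> R v = Some w)" for x w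
    by (simp add: R(3)[symmetric] map_comp_Some_iff)
  have A_zero: "A 0 = 0" by (simp add: bounded_linear.linear[OF A] linear_0)
  have inj: "x = y" if "R x = Some v" "R y = Some v" for x y v
  proof -
    have y: "y \<in> dom R" using that by blast
    have xy: "x \<in> dom R" "(-1) *\<^sub>R y \<in> dom R" using that L(3)[OF y, of "-1"] by auto
    have "R (x - y) = Some 0" using L(1)[OF xy] L(3)[OF y, of "-1"] that by simp
    moreover have "R 0 = Some 0" using L(3)[OF xy(1), of 0] by simp
    ultimately have "T (x - y) = Some 0" using RR by blast
    then show ?thesis using T A_zero by simp
  qed
  define Q where "Q w = the (R (A w))" for w
  have RQ: "R (Q w) = Some w" for w
  proof -
    have "T (A w) = Some w" using T by simp
    then show ?thesis unfolding RR Q_def by auto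
  qed
  have Q_dom: "Q w \<in> dom R" for w using RQ by blast
  have R_iff: "R x = Some w \<longleftrightarrow> x = Q w" for x w using inj RQ by blast
  have QQ: "Q (Q w) = A w" for w using RR[of "Q (Q w)" w] RQ T by blast
  have Q_add: "Q (x + y) = Q x + Q y" for x y
    using L(1)[OF Q_dom Q_dom, of x y] R_iff by (simp add: RQ)
  have Q_scale: "Q (r *\<^sub>R x) = r *\<^sub>R Q x" for r x
    using L(3)[OF Q_dom, of r x] R_iff by (simp add: RQ)
  have Q_sym: "inner (Q x) y = inner x (Q y)" for x y
    using symmetric_op_inner[OF selfadjoint_op_symmetric[OF R(1)] Q_dom Q_dom, of x y]
    by (simp add: RQ)
  have Q_nonneg: "0 \<le> inner (Q x) x" for x
  proof -
    have "0 * (norm (Q x))\<^sup>2 \<le> Re (cinner (the (R (Q x))) (Q x))"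
      using R(2) Q_dom unfolding bounded_below_by_def by blast
    then show ?thesis by (simp add: Re_cinner RQ inner_commute)
  qed
  obtain K where K: "\<And>x. norm (A x) \<le> norm x * K" "K \<ge> 0"
    using bounded_linear.nonneg_bounded[OF A] by blast
  have "bounded_linear Q"
  proof (rule bounded_linear_intro[OF Q_add Q_scale])
    fix x
    \<comment> \<open>Boundedness of the root follows from that of its square, by symmetry.\<close>
    have "(norm (Q x))\<^sup>2 = inner (A x) x" by (simp add: power2_norm_eq_inner Q_sym inner_commute flip: QQ)
    also have "\<dots> \<le> norm (A x) * norm x" by (rule norm_cauchy_schwarz)
    also have "\<dots> \<le> norm x * K * norm x" using K by (intro mult_right_mono) auto
    also have "\<dots> = (norm x * sqrt K)\<^sup>2" using K(2) by (simp add: power2_eq_square)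
    finally show "norm (Q x) \<le> norm x * sqrt K" by (rule power2_le_imp_le) (simp add: K(2))
  qed
  then have Q: "linear Q" by (rule bounded_linear.linear)
  have comm: "Q (P x) = P (Q x)" for x
    using P_comm[OF \<open>bounded_linear Q\<close>] by (simp flip: QQ)
  have "P y = Q y" for y
  proof -
    define w where "w = P y - Q y"
    have "P w + Q w = 0"
      by (simp add: w_def linear_diff[OF P] linear_diff[OF Q] PP QQ comm)
    then have "inner (P w) w + inner (Q w) w = 0" by (simp flip: inner_add_left)
    then have "inner (Q w) w = 0" using P_nonneg[of w] Q_nonneg[of w] by linarith
    then have "Q w = 0" by (rule nonneg_form_zero[OF Q Q_sym Q_nonneg])
    then have "R (Q 0) = Some w" using RQ[of w] \<open>Q w = 0\<close> linear_0[OF Q] by simp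
    then have "w = 0" using RQ[of 0] by simp
    then show ?thesis by (simp add: w_def)
  qed
  then show ?thesis using R_iff by simp
qed

text \<open>Everything is expressed through the bounded operator \<open>P = T^(-1/2)\<close>, found
  as the root of the bounded inverse of \<open>T\<close>; its own inverse is the unbounded square
  root.\<close>

lemma uniformly_positive_op_sqrt:
  fixes T :: "'a::chilbert_space \<rightharpoonup> 'a"
  assumes "uniformly_positive_op T"
  obtains P where "bounded_linear P" "\<forall>x y. cinner (P x) y = cinner x (P y)"
    "\<forall>x u. T x = Some u \<longleftrightarrow> x = P (P u)" "\<forall>x u. op_sqrt T x = Some u \<longleftrightarrow> x = P u"
proof -
  obtain c where T: "selfadjoint_op T" and c: "c > 0"
    and below: "\<And>x. x \<in> dom T \<Longrightarrow> c * (norm x)\<^sup>2 \<le> inner (the (T x)) x"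
    using assms by (auto simp: uniformly_positive_op_def bounded_below_by_def Re_cinner)
  have lin: "linear_op T" and dense: "closure (dom T) = UNIV"
    using T by (auto simp: selfadjoint_op_def)
  note L = linear_opD[OF lin]
  have "\<exists>x\<in>dom T. the (T x) = y" for y
    using selfadjoint_op_surj[OF T, of 1 c 0 y] c below by simp
  then obtain A where A: "\<And>y. A y \<in> dom T" "\<And>y. the (T (A y)) = y" by metis
  have TA: "T (A y) = Some y" for y using A[of y] by auto
  have T_iff: "T x = Some u \<longleftrightarrow> x = A u" for x u
  proof
    assume x: "T x = Some u"
    have d: "x \<in> dom T" "(-1) *\<^sub>R A u \<in> dom T" using x L(3)[OF A(1), of "-1"] by auto
    have "T (x - A u) = Some 0" using L(1)[OF d] L(3)[OF A(1)[of u], of "-1"] x TA by simp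
    then have "c * (norm (x - A u))\<^sup>2 \<le> 0" using below[of "x - A u"] by auto
    then show "x = A u" using c by (simp add: mult_le_0_iff)
  qed (simp add: TA)
  have A_sym: "inner (A x) y = inner x (A y)" for x y
    using symmetric_op_inner[OF selfadjoint_op_symmetric[OF T] A(1) A(1), of x y] by (simp add: A(2))
  have A_le: "c * (norm (A x))\<^sup>2 \<le> inner (A x) x" for x
    using below[OF A(1), of x] by (simp add: A(2) inner_commute)
  have A_scaleC: "A (a *\<^sub>C x) = a *\<^sub>C A x" for a x
    using L(2)[OF A(1), of a x] T_iff by (simp add: A(2))
  have "bounded_linear A"
  proof (rule bounded_linear_intro)
    show "A (x + y) = A x + A y" for x y
      using L(1)[OF A(1) A(1), of x y] T_iff by (simp add: A(2))
    show "A (r *\<^sub>R x) = r *\<^sub>R A x" for r x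
      using L(3)[OF A(1), of r x] T_iff by (simp add: A(2))
    show "norm (A x) \<le> norm x * (1 / c)" for x
    proof (cases "A x = 0")
      case False
      have "(c * norm (A x)) * norm (A x) \<le> norm x * norm (A x)"
        using A_le[of x] norm_cauchy_schwarz[of "A x" x] by (simp add: power2_eq_square ac_simps)
      then show ?thesis using False c by (simp add: field_simps)
    qed (use c in simp)
  qed
  \<comment> \<open>The factor \<open>c\<close> brings the inverse between 0 and 1, as
    \<open>bounded_operator_sqrt\<close> demands; dividing the root by \<open>sqrt c\<close> undoes
    it.\<close>
  define A' where "A' x = c *\<^sub>R A x" for x
  have "bounded_linear A'"
    unfolding A'_def[abs_def] by (intro bounded_linear_const_scaleR \<open>bounded_linear A\<close>)
  moreover have "inner (A' x) y = inner x (A' y)" for x y by (simp add: A'_def A_sym)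
  moreover have "(norm (A' x))\<^sup>2 \<le> inner (A' x) x" for x
    using mult_left_mono[OF A_le, of c x] c by (simp add: A'_def power_mult_distrib power2_eq_square ac_simps)
  ultimately obtain P0 where P0: "bounded_linear P0" "\<forall>x y. inner (P0 x) y = inner x (P0 y)"
    "\<forall>x. 0 \<le> inner (P0 x) x" "\<forall>x. P0 (P0 x) = A' x"
    "\<forall>C. bounded_linear C \<longrightarrow> (\<forall>x. C (A' x) = A' (C x)) \<longrightarrow> (\<forall>x. C (P0 x) = P0 (C x))"
    using bounded_operator_sqrt[of A'] by blast
  define P where "P x = (1 / sqrt c) *\<^sub>R P0 x" for x
  have P: "bounded_linear P"
    unfolding P_def[abs_def] by (intro bounded_linear_const_scaleR P0(1))
  have P_sym: "inner (P x) y = inner x (P y)" for x y by (simp add: P_def P0(2))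
  have P_nonneg: "0 \<le> inner (P x) x" for x using P0(3) c by (simp add: P_def)
  have PP: "P (P x) = A x" for x
    using c by (simp add: P_def linear_scale[OF bounded_linear.linear[OF P0(1)]] P0(4) A'_def)
  have P_comm: "C (P x) = P (C x)" if C: "bounded_linear C" and "\<And>x. C (A x) = A (C x)" for C x
  proof -
    note scale = linear_scale[OF bounded_linear.linear[OF C]]
    have "\<forall>x. C (A' x) = A' (C x)" using that(2) by (simp add: A'_def scale)
    then have "C (P0 x) = P0 (C x)" using P0(5) C by blast
    then show ?thesis by (simp add: P_def scale)
  qed
  \<comment> \<open>The root was built over the reals. Complex linearity follows because
    multiplication by \<open>\<i>\<close> commutes with \<open>A\<close>, hence with
    \<open>P\<close>.\<close>
  have P_i: "P (\<i> *\<^sub>C x) = \<i> *\<^sub>C P x" for x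
    using P_comm[OF bounded_linear_scaleC, of \<i>] A_scaleC by simp
  note Pl = bounded_linear.linear[OF P]
  have P_csym: "cinner (P x) y = cinner x (P y)" for x y by (rule cinner_sym_of_inner[OF Pl P_i P_sym])
  have inj: "u = v" if "P u = P v" for u v
  proof -
    have "A u = A v" using that by (simp flip: PP)
    then show ?thesis using TA by (metis option.inject)
  qed
  define R where "R x = (if x \<in> range P then Some (inv P x) else None)" for x
  have R_iff: "R x = Some u \<longleftrightarrow> x = P u" for x u
    using inj by (auto simp: R_def f_inv_into_f inv_f_f inj_def split: if_splits)
  have "dom T \<subseteq> range P" using T_iff by (auto simp flip: PP)
  then have "closure (range P) = UNIV" using dense closure_mono by blast
  then have R: "selfadjoint_op R"
    using selfadjoint_op_inverse[OF Pl P_csym scaleC_linear[OF Pl P_i] _ R_iff] by blast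
  have R_nonneg: "bounded_below_by R 0"
    unfolding bounded_below_by_def
  proof
    fix x assume "x \<in> dom R"
    then obtain u where u: "R x = Some u" by blast
    then have xu: "x = P u" using R_iff by blast
    show "0 * (norm x)\<^sup>2 \<le> Re (cinner (the (R x)) x)"
      unfolding u using P_nonneg[of u] by (simp add: xu Re_cinner inner_commute)
  qed
  have RR: "R \<circ>\<^sub>m R = T"
  proof
    fix x
    have "(R \<circ>\<^sub>m R) x = Some w \<longleftrightarrow> T x = Some w" for w
      by (simp add: map_comp_Some_iff R_iff T_iff flip: PP)
    then show "(R \<circ>\<^sub>m R) x = T x" by (metis option.exhaust)
  qed
  have "op_sqrt T = R"
    unfolding op_sqrt_def
  proof (rule the_equality)
    fix R' assume "selfadjoint_op R' \<and> bounded_below_by R' 0 \<and> R' \<circ>\<^sub>m R' = T"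
    then have "R' x = Some u \<longleftrightarrow> R x = Some u" for x u
      unfolding R_iff using P_comm
      by (intro nonneg_sqrt_unique[OF \<open>bounded_linear A\<close> T_iff Pl P_sym P_nonneg PP]) auto
    then show "R' = R" by (metis ext option.exhaust)
  qed (simp add: R R_nonneg RR)
  then show thesis using that[of P] P P_csym T_iff R_iff by (simp add: PP)
qed

section \<open>Perturbations that are negligible in the form sense\<close>

text \<open>The summand 1 keeps the denominator positive where the form of \<open>T\<close>
  vanishes. Negligibility can then be shown for one component of \<open>T\<close> alone, before the
  assumption on \<open>ess_num_range T\<close> is used.\<close>

definition form_negligible :: "('a::chilbert_space \<rightharpoonup> 'a) \<Rightarrow> ('a \<rightharpoonup> 'a) \<Rightarrow> bool" where
  "form_negligible S T \<longleftrightarrow> dom T \<subseteq> dom S \<and>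
     (\<forall>x :: nat \<Rightarrow> 'a. (\<forall>n. x n \<in> dom T \<and> norm (x n) = 1) \<longrightarrow> weakly_null x \<longrightarrow>
        (\<lambda>n. cmod (cinner (the (S (x n))) (x n)) / (1 + cmod (cinner (the (T (x n))) (x n)))) \<longlonglongrightarrow> 0)"

lemma weakly_null_inner: "weakly_null x \<Longrightarrow> (\<lambda>n. inner y (x n)) \<longlonglongrightarrow> 0"
  using tendsto_Re[of "\<lambda>n. cinner (x n) y" 0] by (simp add: weakly_null_def Re_cinner inner_commute)

lemma weakly_null_subseq:
  assumes "weakly_null x" and r: "strict_mono r"
  shows "weakly_null (\<lambda>n. x (r n))"
  unfolding weakly_null_def
proof
  fix y
  have "(\<lambda>n. cinner (x n) y) \<longlonglongrightarrow> 0" using assms by (simp add: weakly_null_def)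
  from LIMSEQ_subseq_LIMSEQ[OF this r] show "(\<lambda>n. cinner (x (r n)) y) \<longlonglongrightarrow> 0" by (simp add: o_def)
qed

text \<open>A larger form in the denominator only decreases the quotient. This passes from a
  component of \<open>T\<close>, possibly with a larger domain, to \<open>T\<close>.\<close>

lemma form_negligible_mono:
  assumes S: "form_negligible S R" and dom: "dom T \<subseteq> dom R"
    and le: "\<And>x. x \<in> dom T \<Longrightarrow> cmod (cinner (the (R x)) x) \<le> cmod (cinner (the (T x)) x)"
  shows "form_negligible S T"
  unfolding form_negligible_def
proof (intro conjI allI impI)
  show "dom T \<subseteq> dom S" using S dom by (auto simp: form_negligible_def)
  fix x :: "nat \<Rightarrow> 'a" assume x: "\<forall>n. x n \<in> dom T \<and> norm (x n) = 1" "weakly_null x"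
  then have "(\<lambda>n. cmod (cinner (the (S (x n))) (x n)) / (1 + cmod (cinner (the (R (x n))) (x n)))) \<longlonglongrightarrow> 0"
    using S dom unfolding form_negligible_def by blast
  then show "(\<lambda>n. cmod (cinner (the (S (x n))) (x n)) / (1 + cmod (cinner (the (T (x n))) (x n)))) \<longlonglongrightarrow> 0"
    by (rule Lim_null_comparison[rotated])
      (use x le in \<open>auto intro!: always_eventually divide_left_mono mult_pos_pos add_pos_nonneg\<close>)
qed

section \<open>Negligibility of sums and of relatively compact perturbations\<close>

lemma dom_op_add_scale: "dom (S1 +\<^sub>o c *\<^sub>o S2) = dom S1 \<inter> dom S2"
  by (auto simp: op_add_def op_scale_def dom_def split: if_splits)

lemma cinner_op_add_scale:
  assumes "x \<in> dom S1" "x \<in> dom S2"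
  shows "cinner (the ((S1 +\<^sub>o c *\<^sub>o S2) x)) y = cinner (the (S1 x)) y + c * cinner (the (S2 x)) y"
  using assms by (auto simp: op_add_def op_scale_def dom_def cinner_add_left cinner_scaleC_left)

lemma form_negligible_add_scale:
  assumes "form_negligible S1 T" "form_negligible S2 T"
  shows "form_negligible (S1 +\<^sub>o \<i> *\<^sub>o S2) T"
  unfolding form_negligible_def
proof (intro conjI allI impI)
  show dom: "dom T \<subseteq> dom (S1 +\<^sub>o \<i> *\<^sub>o S2)"
    using assms by (auto simp: form_negligible_def dom_op_add_scale)
  fix x :: "nat \<Rightarrow> 'a" assume x: "\<forall>n. x n \<in> dom T \<and> norm (x n) = 1" "weakly_null x"
  define d where "d n = 1 + cmod (cinner (the (T (x n))) (x n))" for n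
  have d: "d n \<ge> 0" for n by (simp add: d_def)
  define a b where "a n = cmod (cinner (the (S1 (x n))) (x n)) / d n"
    and "b n = cmod (cinner (the (S2 (x n))) (x n)) / d n" for n
  have "a \<longlonglongrightarrow> 0" "b \<longlonglongrightarrow> 0"
    using assms x unfolding a_def[abs_def] b_def[abs_def] d_def form_negligible_def by blast+
  then have lim: "(\<lambda>n. a n + b n) \<longlonglongrightarrow> 0" using tendsto_add by fastforce
  show "(\<lambda>n. cmod (cinner (the ((S1 +\<^sub>o \<i> *\<^sub>o S2) (x n))) (x n))
      / (1 + cmod (cinner (the (T (x n))) (x n)))) \<longlonglongrightarrow> 0"
    unfolding d_def[symmetric]
  proof (rule Lim_null_comparison[OF _ lim], intro always_eventually allI)
    fix n
    have "x n \<in> dom S1 \<inter> dom S2" using x(1) dom unfolding dom_op_add_scale by blast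
    then have "x n \<in> dom S1" "x n \<in> dom S2" by blast+
    then have "cmod (cinner (the ((S1 +\<^sub>o \<i> *\<^sub>o S2) (x n))) (x n))
        \<le> cmod (cinner (the (S1 (x n))) (x n)) + cmod (cinner (the (S2 (x n))) (x n))"
      using norm_triangle_ineq[of "cinner (the (S1 (x n))) (x n)" "\<i> * cinner (the (S2 (x n))) (x n)"]
      by (simp add: cinner_op_add_scale norm_mult)
    from divide_right_mono[OF this d[of n]]
    show "norm (cmod (cinner (the ((S1 +\<^sub>o \<i> *\<^sub>o S2) (x n))) (x n)) / d n) \<le> a n + b n"
      using d[of n] by (simp add: a_def b_def add_divide_distrib)
  qed
qed

text \<open>With \<open>G = s R + l\<close>, boundedness of \<open>y\<close> and \<open>G y\<close>
  bounds \<open>R y\<close>, so compactness relative to \<open>R\<close> can be used for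
  \<open>G\<close>. On unit vectors the energy is at most \<open>(1 + l) (1 + |<R x, x>|)\<close>,
  which converts the ratio with \<open>G\<close> into the required one.\<close>

lemma form_negligible_semibounded:
  assumes R: "selfadjoint_op R" "semibounded_op R" and S: "symmetric_op S"
    and compact: "relatively_compact_op S R"
  shows "form_negligible S R"
  unfolding form_negligible_def
proof (intro conjI allI impI)
  show dom: "dom R \<subseteq> dom S" using compact by (simp add: relatively_compact_op_def)
  fix x :: "nat \<Rightarrow> 'a" assume x: "\<forall>n. x n \<in> dom R \<and> norm (x n) = 1" "weakly_null x"
  obtain s l where s: "s = 1 \<or> s = -1" and l: "l > (0::real)"
    and co: "coercive_operator (dom R) (\<lambda>x. s *\<^sub>R the (R x) + l *\<^sub>R x)"
    using semibounded_coercive_operator[OF R] .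
  define G where "G x = s *\<^sub>R the (R x) + l *\<^sub>R x" for x
  interpret coercive_operator "dom R" G unfolding G_def[abs_def] by (rule co)
  have lin: "linear_op S" using S by (simp add: symmetric_op_def)
  note L = linear_opD[OF lin]
  have "(\<lambda>n. inner (the (S (x n))) (x n) / inner (G (x n)) (x n)) \<longlonglongrightarrow> 0"
  proof (rule form_ratio_tendsto_zero)
    fix y :: "nat \<Rightarrow> 'a"
    assume y: "range y \<subseteq> dom R" "bounded (range y)" "bounded (range (\<lambda>n. G (y n)))"
    obtain B C where B: "\<And>n. norm (y n) \<le> B" and C: "\<And>n. norm (G (y n)) \<le> C"
      using y(2,3) by (auto simp: bounded_iff)
    have "norm (the (R (y n))) \<le> C + l * B" for n
    proof -
      have "norm (the (R (y n))) = norm (G (y n) - l *\<^sub>R y n)" using s by (auto simp: G_def)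
      also have "\<dots> \<le> norm (G (y n)) + l * norm (y n)"
        using norm_triangle_ineq4[of "G (y n)" "l *\<^sub>R y n"] l by simp
      also have "\<dots> \<le> C + l * B" using B C l by (intro add_mono mult_left_mono) auto
      finally show ?thesis .
    qed
    then have "bounded (range (\<lambda>n. the (R (y n))))" by (intro boundedI[of _ "C + l * B"]) auto
    then show "\<exists>r. strict_mono r \<and> convergent (\<lambda>n. the (S (y (r n))))"
      using compact y(1,2) unfolding relatively_compact_op_def by blast
  next
    fix a b assume "a \<in> dom R" "b \<in> dom R"
    then have ab: "a \<in> dom S" "b \<in> dom S" using dom by auto
    then show "the (S (a + b)) = the (S a) + the (S b)" by (simp add: L(1))
    show "inner (the (S a)) b = inner a (the (S b))" using ab by (rule symmetric_op_inner[OF S])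
  next
    fix a and r :: real assume "a \<in> dom R"
    then show "the (S (r *\<^sub>R a)) = r *\<^sub>R the (S a)" using dom by (simp add: L(3) subset_iff)
  qed (use x weakly_null_inner in auto)
  then have "(\<lambda>n. (1 + l) * \<bar>inner (the (S (x n))) (x n) / inner (G (x n)) (x n)\<bar>) \<longlonglongrightarrow> 0"
    by (intro tendsto_mult_right_zero tendsto_rabs_zero)
  then show "(\<lambda>n. cmod (cinner (the (S (x n))) (x n)) / (1 + cmod (cinner (the (R (x n))) (x n)))) \<longlonglongrightarrow> 0"
  proof (rule Lim_null_comparison[rotated], intro always_eventually allI)
    fix n
    have xn: "x n \<in> dom R" "x n \<in> dom S" "norm (x n) = 1" using x(1) dom by auto
    define p q t where "p = inner (G (x n)) (x n)" and "q = \<bar>inner (the (S (x n))) (x n)\<bar>"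
      and "t = \<bar>inner (the (R (x n))) (x n)\<bar>"
    have "p \<ge> 1" using coercive[OF xn(1)] xn(3) by (simp add: p_def)
    have "inner (x n) (x n) = 1" using xn(3) by (simp add: dot_square_norm)
    then have "p \<le> t + l" using s by (auto simp: p_def t_def G_def inner_add_left)
    also have "\<dots> \<le> (1 + l) * (1 + t)" using l by (simp add: t_def algebra_simps)
    finally have "q * p \<le> q * ((1 + l) * (1 + t))" by (intro mult_left_mono) (auto simp: q_def)
    then have "q / (1 + t) \<le> (1 + l) * (q / p)"
      using \<open>p \<ge> 1\<close> by (simp add: t_def divide_le_eq le_divide_eq ac_simps)
    then show "norm (cmod (cinner (the (S (x n))) (x n)) / (1 + cmod (cinner (the (R (x n))) (x n))))
        \<le> (1 + l) * \<bar>inner (the (S (x n))) (x n) / inner (G (x n)) (x n)\<bar>"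
      using symmetric_op_cinner_self[OF S xn(2)] \<open>p \<ge> 1\<close>
        symmetric_op_cinner_self[OF selfadjoint_op_symmetric[OF R(1)] xn(1)]
      by (simp add: p_def q_def t_def)
  qed
qed

lemma inner_tendsto_zero_dense:
  fixes v :: "nat \<Rightarrow> 'a::real_inner"
  assumes "closure D = UNIV" and bd: "\<And>n. norm (v n) \<le> 1"
    and D: "\<And>h. h \<in> D \<Longrightarrow> (\<lambda>n. inner h (v n)) \<longlonglongrightarrow> 0"
  shows "(\<lambda>n. inner h (v n)) \<longlonglongrightarrow> 0"
proof (rule tendstoI)
  fix e :: real assume e: "e > 0"
  have "h \<in> closure D" using assms(1) by simp
  then obtain g where g: "g \<in> D" "norm (h - g) < e / 2"
    using e unfolding closure_approachable by (metis dist_commute dist_norm half_gt_zero)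
  have "\<forall>\<^sub>F n in sequentially. \<bar>inner g (v n)\<bar> < e / 2"
    using tendstoD[OF D[OF g(1)], of "e / 2"] e by simp
  then show "\<forall>\<^sub>F n in sequentially. dist (inner h (v n)) 0 < e"
  proof eventually_elim
    case (elim n)
    have "\<bar>inner (h - g) (v n)\<bar> \<le> norm (h - g) * 1"
      using Cauchy_Schwarz_ineq2[of "h - g" "v n"] mult_left_mono[OF bd[of n], of "norm (h - g)"]
      by simp
    then show ?case using elim g(2) by (simp add: inner_diff_left)
  qed
qed

lemma cinner_tendsto_zero:
  fixes a v :: "nat \<Rightarrow> 'a::chilbert_space"
  assumes "a \<longlonglongrightarrow> w" and "\<And>h. (\<lambda>n. inner h (v n)) \<longlonglongrightarrow> 0" and "\<And>n. norm (v n) \<le> C"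
  shows "(\<lambda>n. cinner (a n) (v n)) \<longlonglongrightarrow> 0"
  unfolding tendsto_complex_iff Re_cinner Im_cinner
proof
  show "(\<lambda>n. inner (a n) (v n)) \<longlonglongrightarrow> Re 0"
    using inner_tendsto_zero[OF assms] by simp
  have "(\<lambda>n. \<i> *\<^sub>C a n) \<longlonglongrightarrow> \<i> *\<^sub>C w"
    by (rule bounded_linear.tendsto[OF bounded_linear_scaleC assms(1)])
  from inner_tendsto_zero[OF this assms(2,3)]
  show "(\<lambda>n. - inner (\<i> *\<^sub>C a n) (v n)) \<longlonglongrightarrow> Im 0" by (auto intro: tendsto_eq_intros)
qed

text \<open>Writing \<open>x = P u\<close> with \<open>P = R^(-1/2)\<close> turns the form of
  \<open>R\<close> into \<open>(norm u)^2\<close> and that of \<open>S\<close> into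
  \<open><P S x, u>\<close>, so normalising \<open>u\<close> produces exactly the quotient to be
  estimated.\<close>

lemma form_negligible_uniformly_positive:
  assumes R: "uniformly_positive_op R" and S: "linear_op S"
    and compact: "relatively_compact_op (op_inverse (op_sqrt R) \<circ>\<^sub>m S) (op_sqrt R)"
  shows "form_negligible S R"
  unfolding form_negligible_def
proof (intro conjI allI impI)
  obtain P where P: "bounded_linear P" and P_props: "\<forall>x y. cinner (P x) y = cinner x (P y)"
      "\<forall>x u. R x = Some u \<longleftrightarrow> x = P (P u)" "\<forall>x u. op_sqrt R x = Some u \<longleftrightarrow> x = P u"
    using uniformly_positive_op_sqrt[OF R] by blast
  have P_sym: "cinner (P x) y = cinner x (P y)" for x y using P_props(1) by blast
  have R_iff: "R x = Some u \<longleftrightarrow> x = P (P u)" for x u using P_props(2) by blast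
  have sqrt: "op_sqrt R x = Some u \<longleftrightarrow> x = P u" for x u using P_props(3) by blast
  have P_isym: "inner (P x) y = inner x (P y)" for x y by (simp add: P_sym flip: Re_cinner)
  have sqrt_P: "op_sqrt R (P u) = Some u" for u using sqrt by blast
  have dom_sqrt: "dom (op_sqrt R) = range P" using sqrt by (auto simp: dom_def)
  \<comment> \<open>The inverse is defined everywhere, so composing with it does not shrink the
    domain of \<open>S\<close>.\<close>
  have inv: "op_inverse (op_sqrt R) = (\<lambda>y. Some (P y))"
  proof
    fix y
    have "y \<in> ran (op_sqrt R)" using sqrt_P by (auto simp: ran_def)
    then show "op_inverse (op_sqrt R) y = Some (P y)" by (simp add: op_inverse_def sqrt)
  qed
  have dom_S: "range P \<subseteq> dom S"
    using compact by (auto simp: relatively_compact_op_def dom_sqrt inv map_comp_def split: option.splits)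
  have dom_R: "dom R \<subseteq> range P" using R_iff by auto
  then show "dom R \<subseteq> dom S" using dom_S by blast
  have "closure (dom R) = UNIV"
    using R by (simp add: uniformly_positive_op_def selfadjoint_op_def)
  then have dense: "closure (range P) = UNIV" using closure_mono[OF dom_R] by blast
  obtain K where K: "K > 0" "\<And>x. norm (P x) \<le> norm x * K"
    using bounded_linear.pos_bounded[OF P] by blast
  fix x :: "nat \<Rightarrow> 'a" assume x: "\<forall>n. x n \<in> dom R \<and> norm (x n) = 1" "weakly_null x"
  define u where "u n = P (the (R (x n)))" for n
  have xu: "x n = P (u n)" for n
  proof -
    have "x n \<in> dom R" using x(1) by blast
    then have "R (x n) = Some (the (R (x n)))" by auto
    then show ?thesis unfolding R_iff u_def .
  qed
  have Ru: "cinner (the (R (x n))) (x n) = cinner (u n) (u n)" for n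
  proof -
    have "cinner (the (R (x n))) (P (u n)) = cinner (u n) (u n)" by (simp add: u_def P_sym)
    then show ?thesis unfolding xu[symmetric] .
  qed
  \<comment> \<open>Unit vectors \<open>x n\<close> keep \<open>u n\<close> away from 0, so the
    normalising factors stay bounded by \<open>K\<close>.\<close>
  have uK: "1 \<le> norm (u n) * K" for n using K(2)[of "u n"] x(1) by (simp flip: xu)
  have u0: "norm (u n) > 0" for n
  proof (rule ccontr)
    assume "\<not> norm (u n) > 0"
    then show False using uK[of n] by simp
  qed
  then have u: "norm (u n) > 0" "1 / norm (u n) \<le> K" for n
    using uK[of n] by (simp_all add: divide_le_eq mult.commute)
  define v where "v n = (1 / norm (u n)) *\<^sub>R u n" for n
  have v: "norm (v n) = 1" for n using u[of n] by (simp add: v_def)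
  have Pv: "P (v n) = (1 / norm (u n)) *\<^sub>R x n" for n
    by (simp add: v_def xu linear_scale[OF bounded_linear.linear[OF P]])
  \<comment> \<open>Against \<open>P g\<close> the pairing with \<open>v n\<close> is
    \<open><g, x n> / norm (u n)\<close>, which tends to 0; the dense range of \<open>P\<close> and
    the bound on \<open>v n\<close> do the rest.\<close>
  have weak: "(\<lambda>n. inner h (v n)) \<longlonglongrightarrow> 0" for h
  proof (rule inner_tendsto_zero_dense[OF dense])
    fix h assume "h \<in> range P"
    then obtain g where h: "h = P g" by blast
    have lim: "(\<lambda>n. K * \<bar>inner g (x n)\<bar>) \<longlonglongrightarrow> 0"
      using weakly_null_inner[OF x(2)] by (intro tendsto_mult_right_zero tendsto_rabs_zero)
    have le: "norm (inner h (v n)) \<le> K * \<bar>inner g (x n)\<bar>" for n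
      using mult_right_mono[OF u(2), of "\<bar>inner g (x n)\<bar>" n] u(1)[of n]
      by (simp add: h P_isym Pv abs_mult)
    show "(\<lambda>n. inner h (v n)) \<longlonglongrightarrow> 0"
      by (rule Lim_null_comparison[OF _ lim]) (intro always_eventually allI le)
  qed (simp add: v)
  have "(\<lambda>n. cinner (the (S (P (v n)))) (P (v n))) \<longlonglongrightarrow> 0"
  proof (rule tendsto_zero_subseqI)
    fix r :: "nat \<Rightarrow> nat" assume r: "strict_mono r"
    define y where "y n = P (v (r n))" for n
    have "range y \<subseteq> dom (op_sqrt R)" by (auto simp: y_def dom_sqrt)
    moreover have "bounded (range y)"
      using K(2)[of "v n" for n] by (intro boundedI[of _ K]) (auto simp: y_def v)
    moreover have "bounded (range (\<lambda>n. the (op_sqrt R (y n))))"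
      by (intro boundedI[of _ 1]) (auto simp: y_def v sqrt_P)
    ultimately obtain s w where s: "strict_mono (s :: nat \<Rightarrow> nat)"
      and w: "(\<lambda>n. the ((op_inverse (op_sqrt R) \<circ>\<^sub>m S) (y (s n)))) \<longlonglongrightarrow> w"
      using compact unfolding relatively_compact_op_def convergent_def by blast
    have "the ((op_inverse (op_sqrt R) \<circ>\<^sub>m S) (y n)) = P (the (S (y n)))" for n
    proof -
      have "y n \<in> dom S" using dom_S by (auto simp: y_def)
      then show ?thesis by (auto simp: inv map_comp_def)
    qed
    then have "(\<lambda>n. P (the (S (y (s n))))) \<longlonglongrightarrow> w" using w by simp
    moreover have "(\<lambda>n. inner h (v (r (s n)))) \<longlonglongrightarrow> 0" for h
      using LIMSEQ_subseq_LIMSEQ[OF weak strict_mono_o[OF r s]] by (simp add: o_def)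
    ultimately have "(\<lambda>n. cinner (P (the (S (y (s n))))) (v (r (s n)))) \<longlonglongrightarrow> 0"
      by (rule cinner_tendsto_zero[where C = 1]) (simp add: v)
    then show "\<exists>s. strict_mono s \<and> (\<lambda>n. cinner (the (S (P (v (r (s n)))))) (P (v (r (s n))))) \<longlonglongrightarrow> 0"
      using s by (auto simp: P_sym y_def)
  qed
  then have "(\<lambda>n. cmod (cinner (the (S (P (v n)))) (P (v n)))) \<longlonglongrightarrow> 0" by (rule tendsto_norm_zero)
  then show "(\<lambda>n. cmod (cinner (the (S (x n))) (x n)) / (1 + cmod (cinner (the (R (x n))) (x n)))) \<longlonglongrightarrow> 0"
  proof (rule Lim_null_comparison[rotated], intro always_eventually allI)
    fix n
    define q where "q = cmod (cinner (u n) (u n))"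
    have "(norm (u n))\<^sup>2 \<le> q"
      using complex_Re_le_cmod[of "cinner (u n) (u n)"] by (simp add: q_def Re_cinner power2_norm_eq_inner)
    then have q: "(norm (u n))\<^sup>2 \<le> 1 + q" by simp
    have "x n \<in> dom S" using dom_S by (subst xu) blast
    then have "cinner (the (S (P (v n)))) (P (v n)) = (1 / (norm (u n))\<^sup>2) *\<^sub>R cinner (the (S (x n))) (x n)"
      by (simp add: Pv linear_opD(3)[OF S] bounded_bilinear.scaleR_left[OF bounded_bilinear_cinner]
          bounded_bilinear.scaleR_right[OF bounded_bilinear_cinner] power2_eq_square)
    then have "cmod (cinner (the (S (P (v n)))) (P (v n))) = cmod (cinner (the (S (x n))) (x n)) / (norm (u n))\<^sup>2"
      by simp
    moreover have "cmod (cinner (the (S (x n))) (x n)) / (1 + q)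
        \<le> cmod (cinner (the (S (x n))) (x n)) / (norm (u n))\<^sup>2"
      using q u(1)[of n] by (intro divide_left_mono) (auto simp: q_def add_pos_nonneg)
    ultimately show "norm (cmod (cinner (the (S (x n))) (x n)) / (1 + cmod (cinner (the (R (x n))) (x n))))
        \<le> cmod (cinner (the (S (P (v n)))) (P (v n)))"
      by (simp add: Ru q_def)
  qed
qed

section \<open>From negligible forms to equality of the essential numerical ranges\<close>

lemma form_bounded_away:
  assumes "0 \<notin> ess_num_range T" and x: "\<And>n. x n \<in> dom T" "\<And>n. norm (x n) = 1" "weakly_null x"
  obtains d where "d > 0" "\<forall>\<^sub>F n in sequentially. d \<le> cmod (cinner (the (T (x n))) (x n))"
proof (rule ccontr)
  let ?f = "\<lambda>n. cinner (the (T (x n))) (x n)"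
  note away = that
  assume contr: "\<not> thesis"
  have small: "\<exists>n>m. cmod (?f n) < d" if "d > 0" for m d
  proof -
    have "\<not> (\<forall>\<^sub>F n in sequentially. d \<le> cmod (?f n))" using away[OF that] contr by blast
    then obtain n where "n \<ge> Suc m" "\<not> d \<le> cmod (?f n)" unfolding eventually_sequentially by blast
    then show ?thesis by (intro exI[of _ n]) auto
  qed
  \<comment> \<open>A subsequence along which the form tends to 0 is still weakly null and
    normalised, so it would witness 0 in \<open>ess_num_range T\<close>.\<close>
  have "\<exists>r. \<forall>n. cmod (?f (r n)) < 1 / real (Suc n) \<and> r n < r (Suc n)"
  proof (rule dependent_nat_choice)
    show "\<exists>k. cmod (?f k) < 1 / real (Suc 0)" using small[of "1 / real (Suc 0)" 0] by auto
    show "\<exists>k'. cmod (?f k') < 1 / real (Suc (Suc n)) \<and> k < k'" for k n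
      using small[of "1 / real (Suc (Suc n))" k] by auto
  qed
  then obtain r where r: "\<And>n. cmod (?f (r n)) < 1 / real (Suc n)" "\<And>n. r n < r (Suc n)" by blast
  have "strict_mono r" using r(2) by (simp add: strict_mono_Suc_iff)
  then have "weakly_null (\<lambda>n. x (r n))" by (rule weakly_null_subseq[OF x(3)])
  moreover have "(\<lambda>n. ?f (r n)) \<longlonglongrightarrow> 0"
  proof (rule Lim_null_comparison)
    show "\<forall>\<^sub>F n in sequentially. norm (?f (r n)) \<le> inverse (real (Suc n))"
      using r(1) by (intro always_eventually) (auto simp: inverse_eq_divide less_imp_le)
  qed (rule LIMSEQ_inverse_real_of_nat)
  ultimately have "0 \<in> ess_num_range T"
    unfolding ess_num_range_def by (intro CollectI exI[of _ "\<lambda>n. x (r n)"]) (simp add: x)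
  then show False using assms(1) by blast
qed

lemma form_ratio_null:
  assumes S: "form_negligible S T" and T: "0 \<notin> ess_num_range T"
    and x: "\<And>n. x n \<in> dom T" "\<And>n. norm (x n) = 1" "weakly_null x"
  shows "(\<lambda>n. cinner (the (S (x n))) (x n) / cinner (the (T (x n))) (x n)) \<longlonglongrightarrow> 0"
    and "\<forall>\<^sub>F n in sequentially. cinner (the (T (x n))) (x n) \<noteq> 0"
proof -
  let ?s = "\<lambda>n. cinner (the (S (x n))) (x n)" and ?t = "\<lambda>n. cinner (the (T (x n))) (x n)"
  obtain d where d: "d > 0" "\<forall>\<^sub>F n in sequentially. d \<le> cmod (?t n)"
    using form_bounded_away[OF T x] by blast
  show "\<forall>\<^sub>F n in sequentially. ?t n \<noteq> 0"
    using d(2) by eventually_elim (use d(1) in auto)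
  have "(\<lambda>n. cmod (?s n) / (1 + cmod (?t n))) \<longlonglongrightarrow> 0"
    using S x unfolding form_negligible_def by blast
  then have "(\<lambda>n. (1 / d + 1) * (cmod (?s n) / (1 + cmod (?t n)))) \<longlonglongrightarrow> 0"
    by (rule tendsto_mult_right_zero)
  then show "(\<lambda>n. ?s n / ?t n) \<longlonglongrightarrow> 0"
  proof (rule Lim_null_comparison[rotated])
    show "\<forall>\<^sub>F n in sequentially. norm (?s n / ?t n) \<le> (1 / d + 1) * (cmod (?s n) / (1 + cmod (?t n)))"
      using d(2)
    proof eventually_elim
      case (elim n)
      \<comment> \<open>Once \<open>|<T x, x>| >= d\<close>, the summand 1 is at most
        \<open>|<T x, x>| / d\<close>.\<close>
      have "1 + cmod (?t n) \<le> (1 / d + 1) * cmod (?t n)"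
        using elim d(1) by (simp add: field_simps)
      then have "cmod (?s n) * (1 + cmod (?t n)) \<le> cmod (?s n) * ((1 / d + 1) * cmod (?t n))"
        by (intro mult_left_mono) auto
      moreover have "cmod (?t n) > 0" using elim d(1) by linarith
      ultimately show ?case
        by (simp add: norm_divide divide_le_eq le_divide_eq add_pos_nonneg ac_simps)
    qed
  qed
qed

lemma dom_op_add: "dom (T +\<^sub>o S) = dom T \<inter> dom S"
  by (auto simp: op_add_def dom_def split: if_splits)

lemma cinner_op_add:
  assumes "x \<in> dom T" "x \<in> dom S"
  shows "cinner (the ((T +\<^sub>o S) x)) y = cinner (the (T x)) y + cinner (the (S x)) y"
  using assms by (auto simp: op_add_def dom_def cinner_add_left)

lemma form_sum_ratio:
  assumes S: "form_negligible S T" and T: "0 \<notin> ess_num_range T"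
    and x: "\<And>n. x n \<in> dom T" "\<And>n. norm (x n) = 1" "weakly_null x"
  shows "(\<lambda>n. cinner (the ((T +\<^sub>o S) (x n))) (x n) / cinner (the (T (x n))) (x n)) \<longlonglongrightarrow> 1"
proof -
  have dom: "x n \<in> dom S" for n using S x(1) by (auto simp: form_negligible_def)
  have "(\<lambda>n. 1 + cinner (the (S (x n))) (x n) / cinner (the (T (x n))) (x n)) \<longlonglongrightarrow> 1"
    using tendsto_add[OF tendsto_const form_ratio_null(1)[OF S T x], of 1] by simp
  then show ?thesis
  proof (rule Lim_transform_eventually)
    show "\<forall>\<^sub>F n in sequentially. 1 + cinner (the (S (x n))) (x n) / cinner (the (T (x n))) (x n)
        = cinner (the ((T +\<^sub>o S) (x n))) (x n) / cinner (the (T (x n))) (x n)"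
      using form_ratio_null(2)[OF S T x]
      by eventually_elim (simp add: cinner_op_add x dom add_divide_distrib)
  qed
qed

text \<open>The reciprocal ratio also tends to 1, so one implication gives both.\<close>

lemma tendsto_ratio_swap_iff:
  fixes p q r :: "nat \<Rightarrow> complex"
  assumes qp: "(\<lambda>n. q n / p n) \<longlonglongrightarrow> 1"
  shows "(\<lambda>n. q n / r n) \<longlonglongrightarrow> \<mu> \<longleftrightarrow> (\<lambda>n. p n / r n) \<longlonglongrightarrow> \<mu>"
proof -
  have *: "(\<lambda>n. q n / r n) \<longlonglongrightarrow> \<mu>"
    if qp: "(\<lambda>n. q n / p n) \<longlonglongrightarrow> 1" and p: "(\<lambda>n. p n / r n) \<longlonglongrightarrow> \<mu>" for p q
  proof -
    have "\<forall>\<^sub>F n in sequentially. q n / p n \<noteq> 0"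
      using tendsto_imp_eventually_ne[OF qp, of 0] by simp
    \<comment> \<open>A nonzero ratio forces \<open>p n\<close> to be nonzero, which permits
      cancellation; where \<open>r n = 0\<close>, both sides are 0 by the convention for
      division.\<close>
    then have "\<forall>\<^sub>F n in sequentially. (q n / p n) * (p n / r n) = q n / r n"
      by eventually_elim simp
    moreover have "(\<lambda>n. (q n / p n) * (p n / r n)) \<longlonglongrightarrow> 1 * \<mu>" by (intro tendsto_mult qp p)
    ultimately show ?thesis by (simp only: mult_1 Lim_transform_eventually)
  qed
  have "(\<lambda>n. p n / q n) \<longlonglongrightarrow> 1"
    using tendsto_inverse[OF qp] by (simp add: inverse_eq_divide)
  then show ?thesis using *[OF qp] *[of p q] by blast
qed

text \<open>Domain and denominator are unchanged, so the same sequences witness both sets.\<close>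

lemma ess_num_range_pair_perturb_numerator:
  assumes S: "form_negligible S T" and T: "0 \<notin> ess_num_range T"
  shows "ess_num_range_pair (T +\<^sub>o S) B = ess_num_range_pair T B"
proof -
  have dom: "dom (T +\<^sub>o S) = dom T" using S by (auto simp: form_negligible_def dom_op_add)
  have iff: "(\<lambda>n. cinner (the ((T +\<^sub>o S) (x n))) (x n) / cinner (the (B (x n))) (x n)) \<longlonglongrightarrow> \<mu> \<longleftrightarrow>
      (\<lambda>n. cinner (the (T (x n))) (x n) / cinner (the (B (x n))) (x n)) \<longlonglongrightarrow> \<mu>"
    if x: "\<And>n. x n \<in> dom T" "\<And>n. norm (x n) = 1" "weakly_null x" for x \<mu>
    using tendsto_ratio_swap_iff[OF form_sum_ratio[OF S T x]] .
  show ?thesis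
    unfolding ess_num_range_pair_def dom using iff by (intro Collect_cong ex_cong1) blast
qed

text \<open>Stated for two denominators whose forms are asymptotically equal, so that it can be
  applied in both directions.\<close>

lemma ess_num_range_pair_denominator_subset:
  assumes dom: "dom A \<subseteq> dom P"
    and ratio: "\<And>x. (\<And>n. x n \<in> dom P) \<Longrightarrow> (\<And>n. norm (x n) = 1) \<Longrightarrow> weakly_null x \<Longrightarrow>
      (\<lambda>n. cinner (the (Q (x n))) (x n) / cinner (the (P (x n))) (x n)) \<longlonglongrightarrow> 1"
  shows "ess_num_range_pair A P \<subseteq> ess_num_range_pair A Q"
proof
  fix \<mu> assume "\<mu> \<in> ess_num_range_pair A P"
  then obtain x where x: "\<And>n. x n \<in> dom A" "\<And>n. norm (x n) = 1" "weakly_null x"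
    and lim: "(\<lambda>n. cinner (the (A (x n))) (x n) / cinner (the (P (x n))) (x n)) \<longlonglongrightarrow> \<mu>"
    unfolding ess_num_range_pair_def by blast
  let ?p = "\<lambda>n. cinner (the (P (x n))) (x n)" and ?q = "\<lambda>n. cinner (the (Q (x n))) (x n)"
    and ?a = "\<lambda>n. cinner (the (A (x n))) (x n)"
  have qp: "(\<lambda>n. ?q n / ?p n) \<longlonglongrightarrow> 1" using subsetD[OF dom x(1)] x(2,3) by (rule ratio)
  have nz: "\<forall>\<^sub>F n in sequentially. ?q n / ?p n \<noteq> 0"
    using tendsto_imp_eventually_ne[OF qp, of 0] by simp
  have "(\<lambda>n. (?a n / ?p n) / (?q n / ?p n)) \<longlonglongrightarrow> \<mu>"
    using tendsto_divide[OF lim qp] by simp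
  then have lim': "(\<lambda>n. ?a n / ?q n) \<longlonglongrightarrow> \<mu>"
    by (rule Lim_transform_eventually) (use nz in \<open>eventually_elim; simp\<close>)
  from nz obtain N where N: "\<And>n. n \<ge> N \<Longrightarrow> ?q n \<noteq> 0"
    unfolding eventually_sequentially by auto
  show "\<mu> \<in> ess_num_range_pair A Q"
    unfolding ess_num_range_pair_def
  \<comment> \<open>The definition demands nonzero denominators at every index, whereas those of
    \<open>Q\<close> are nonzero only from \<open>N\<close> on; dropping an initial segment repairs
    this.\<close>
  proof (intro CollectI exI[of _ "\<lambda>n. x (n + N)"] conjI allI)
    show "weakly_null (\<lambda>n. x (n + N))"
      by (rule weakly_null_subseq[OF x(3)]) (simp add: strict_mono_def)
    show "(\<lambda>n. ?a (n + N) / ?q (n + N)) \<longlonglongrightarrow> \<mu>" using LIMSEQ_ignore_initial_segment[OF lim'] .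
  qed (use x N in auto)
qed

lemma ess_num_range_pair_perturb_denominator:
  assumes S: "form_negligible S T" and T: "0 \<notin> ess_num_range T" and A: "dom A \<subseteq> dom T"
  shows "ess_num_range_pair A (T +\<^sub>o S) = ess_num_range_pair A T"
proof
  have dom: "dom (T +\<^sub>o S) = dom T" using S by (auto simp: form_negligible_def dom_op_add)
  show "ess_num_range_pair A T \<subseteq> ess_num_range_pair A (T +\<^sub>o S)"
    using A by (rule ess_num_range_pair_denominator_subset) (rule form_sum_ratio[OF S T])
  \<comment> \<open>The roles are exchanged, with the reciprocal ratio tending to 1.\<close>
  show "ess_num_range_pair A (T +\<^sub>o S) \<subseteq> ess_num_range_pair A T"
  proof (rule ess_num_range_pair_denominator_subset)
    show "dom A \<subseteq> dom (T +\<^sub>o S)" using A dom by simp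
    fix x :: "nat \<Rightarrow> 'a" assume "\<And>n. x n \<in> dom (T +\<^sub>o S)" "\<And>n. norm (x n) = 1" "weakly_null x"
    then have "(\<lambda>n. cinner (the ((T +\<^sub>o S) (x n))) (x n) / cinner (the (T (x n))) (x n)) \<longlonglongrightarrow> 1"
      unfolding dom by (rule form_sum_ratio[OF S T])
    from tendsto_inverse[OF this]
    show "(\<lambda>n. cinner (the (T (x n))) (x n) / cinner (the ((T +\<^sub>o S) (x n))) (x n)) \<longlonglongrightarrow> 1"
      by (simp add: inverse_eq_divide)
  qed
qed

text \<open>For symmetric components the two forms are the real and imaginary part of the form of
  the sum.\<close>

lemma cmod_form_components_le:
  assumes T1: "symmetric_op T1" and T2: "symmetric_op T2" and x: "x \<in> dom (T1 +\<^sub>o \<i> *\<^sub>o T2)"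
  shows "cmod (cinner (the (T1 x)) x) \<le> cmod (cinner (the ((T1 +\<^sub>o \<i> *\<^sub>o T2) x)) x)"
    and "cmod (cinner (the (T2 x)) x) \<le> cmod (cinner (the ((T1 +\<^sub>o \<i> *\<^sub>o T2) x)) x)"
proof -
  have d: "x \<in> dom T1" "x \<in> dom T2" using x by (simp_all add: dom_op_add_scale)
  define z where "z = cinner (the ((T1 +\<^sub>o \<i> *\<^sub>o T2) x)) x"
  have z: "z = complex_of_real (inner (the (T1 x)) x) + \<i> * complex_of_real (inner (the (T2 x)) x)"
    by (simp add: z_def cinner_op_add_scale d symmetric_op_cinner_self[OF T1] symmetric_op_cinner_self[OF T2])
  have "\<bar>Re z\<bar> \<le> cmod z" "\<bar>Im z\<bar> \<le> cmod z" by (rule abs_Re_le_cmod abs_Im_le_cmod)+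
  then show "cmod (cinner (the (T1 x)) x) \<le> cmod z" "cmod (cinner (the (T2 x)) x) \<le> cmod z"
    by (simp_all add: symmetric_op_cinner_self[OF T1] symmetric_op_cinner_self[OF T2] d z)
qed

lemma form_negligible_component:
  assumes "symmetric_op T1" "symmetric_op T2"
  shows "form_negligible S T1 \<Longrightarrow> form_negligible S (T1 +\<^sub>o \<i> *\<^sub>o T2)"
    and "form_negligible S T2 \<Longrightarrow> form_negligible S (T1 +\<^sub>o \<i> *\<^sub>o T2)"
  by (erule form_negligible_mono; use cmod_form_components_le[OF assms] in
      \<open>blast | simp add: dom_op_add_scale\<close>)+

theorem theorem2p26:
  fixes T S :: "'a::chilbert_space \<rightharpoonup> 'a"
  assumes "linear_op T" and "linear_op S"
    and "0 \<notin> ess_num_range T"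
    and "(\<exists>T1 T2 S1 S2.
            T = T1 +\<^sub>o \<i> *\<^sub>o T2 \<and> S = S1 +\<^sub>o \<i> *\<^sub>o S2 \<and>
            symmetric_op T1 \<and> symmetric_op T2 \<and> symmetric_op S1 \<and> symmetric_op S2 \<and>
            (selfadjoint_op T1 \<and> semibounded_op T1 \<and>
               relatively_compact_op S1 T1 \<and> relatively_compact_op S2 T1 \<or>
             selfadjoint_op T2 \<and> semibounded_op T2 \<and>
               relatively_compact_op S1 T2 \<and> relatively_compact_op S2 T2 \<or>
             selfadjoint_op T1 \<and> semibounded_op T1 \<and> selfadjoint_op T2 \<and> semibounded_op T2 \<and>
               relatively_compact_op S1 T1 \<and> relatively_compact_op S2 T2)) \<or>
         (\<exists>T1 T2.
            T = T1 +\<^sub>o \<i> *\<^sub>o T2 \<and> uniformly_positive_op T1 \<and> symmetric_op T2 \<and>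
            relatively_compact_op (op_inverse (op_sqrt T1) \<circ>\<^sub>m S) (op_sqrt T1))"
  shows "(\<forall>B. linear_op B \<and> dom T \<subseteq> dom B \<longrightarrow>
            ess_num_range_pair (T +\<^sub>o S) B = ess_num_range_pair T B) \<and>
         (\<forall>A. linear_op A \<and> dom A \<subseteq> dom T \<longrightarrow>
            ess_num_range_pair A (T +\<^sub>o S) = ess_num_range_pair A T)"
proof -
  have "form_negligible S T"
    using assms(4)
  proof (elim disjE exE conjE)
    fix T1 T2 S1 S2
    assume T: "T = T1 +\<^sub>o \<i> *\<^sub>o T2" and S: "S = S1 +\<^sub>o \<i> *\<^sub>o S2"
      and sym: "symmetric_op T1" "symmetric_op T2" "symmetric_op S1" "symmetric_op S2"
    note component = form_negligible_component[OF sym(1,2)]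
    have sum: "form_negligible S T" if "form_negligible S1 T" "form_negligible S2 T"
      using form_negligible_add_scale[OF that] by (simp add: S)
    {
      assume T1: "selfadjoint_op T1" "semibounded_op T1"
        and "relatively_compact_op S1 T1" "relatively_compact_op S2 T1"
      then show ?thesis
        unfolding T by (intro sum[unfolded T] component(1) form_negligible_semibounded T1 sym)
    next
      assume T2: "selfadjoint_op T2" "semibounded_op T2"
        and "relatively_compact_op S1 T2" "relatively_compact_op S2 T2"
      then show ?thesis
        unfolding T by (intro sum[unfolded T] component(2) form_negligible_semibounded T2 sym)
    next
      assume T1: "selfadjoint_op T1" "semibounded_op T1" and T2: "selfadjoint_op T2" "semibounded_op T2"
        and c: "relatively_compact_op S1 T1" "relatively_compact_op S2 T2"
      \<comment> \<open>In the mixed case each \<open>S\<close> component is compared with its own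
        component of \<open>T\<close>; both comparisons are carried to the common denominator given
        by \<open>T\<close> before adding.\<close>
      have "form_negligible S1 T"
        unfolding T by (rule component(1)[OF form_negligible_semibounded[OF T1 sym(3) c(1)]])
      moreover have "form_negligible S2 T"
        unfolding T by (rule component(2)[OF form_negligible_semibounded[OF T2 sym(4) c(2)]])
      ultimately show ?thesis by (rule sum)
    }
  next
    fix T1 T2
    assume T: "T = T1 +\<^sub>o \<i> *\<^sub>o T2" and T1: "uniformly_positive_op T1" and T2: "symmetric_op T2"
      and c: "relatively_compact_op (op_inverse (op_sqrt T1) \<circ>\<^sub>m S) (op_sqrt T1)"
    have "symmetric_op T1"
      using T1 by (intro selfadjoint_op_symmetric) (simp add: uniformly_positive_op_def)
    then show ?thesis
      unfolding T using form_negligible_component(1)[OF _ T2]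
        form_negligible_uniformly_positive[OF T1 assms(2) c] by blast
  qed
  then show ?thesis
    using assms(3) ess_num_range_pair_perturb_numerator ess_num_range_pair_perturb_denominator
    by blast
qed

end
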